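(* Let $\frac12\le s<1$ and $\Lambda\in\mathbb{N}$, $\Lambda\ge1$. There is a positive constant $C(s)$ depending only on $s$ such that, for $\delta>0$ small enough (depending on $\Lambda$ and $s$), $$\liminf_{\varepsilon\to0}\Big(\inf_{X\in\mathcal{X}^\Lambda:\ \delta(X)\le\delta}\mathcal{E}^s_\varepsilon(X)-\Lambda\sigma^s(\varepsilon)\Big)\ge C(s)\,\sigma^s(\delta).$$
   Context: Let $\mathcal{X}^\Lambda:=[0,\Lambda)^\Lambda$; entries of $X=(x_1,\dots,x_\Lambda)\in\mathcal{X}^\Lambda$ need not be distinct. Let $|t|_{\rm per}:=\min_{z\in\mathbb{Z}}|t+\Lambda z|$ and $\delta(X):=\min_{\lambda\neq\lambda'}|x_\lambda-x_{\lambda'}|_{\rm per}$ (for $\Lambda=1$, $\delta(X):=1$; the infimum over the empty set is $+\infty$). For $\delta>0$, $$\sigma^s(\delta):=\begin{cases}|\log\delta| & \text{if } s=\frac12,\\[2pt] \dfrac{2^{1-2s}}{2s(2s-1)}\,\delta^{1-2s} & \text{if } \frac12<s<1.\end{cases}$$ Let $\mu^X:=\sum_{\lambda=1}^{\Lambda}\sum_{k\in\mathbb{Z}}\delta_{x_\lambda+\Lambda k}$, and let $u^X\in BV_{\rm loc}(\mathbb{R})$ be the function, unique up to additive constants and $\Lambda$-periodic, whose distributional derivative is $(u^X)'=\mathrm{d}x-\mu^X$. Let $\rho$ be a fixed standard mollifier supported in $(-1,1)$ (smooth, nonnegative, even, with integral $1$), $\rho_\varepsilon(x):=\frac1\varepsilon\rho(\frac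 x\varepsilon)$, and $u^X_\varepsilon:=\rho_\varepsilon*u^X$. For $\varepsilon>0$, $$\mathcal{E}^s_\varepsilon(X):=\frac12\int_0^\Lambda \mathrm{d}x\int_{\mathbb{R}}\frac{|u^X_\varepsilon(x)-u^X_\varepsilon(y)|^2}{|x-y|^{1+2s}}\,\mathrm{d}y .$$ *)

theory Defs
  imports "HOL-Analysis.Analysis"
begin

definition smooth :: "(real \<Rightarrow> real) \<Rightarrow> bool" where
  "smooth f \<longleftrightarrow> (\<forall>n. (deriv ^^ n) f differentiable_on UNIV)"

definition test_function :: "(real \<Rightarrow> real) \<Rightarrow> bool" where
  "test_function \<phi> \<longleftrightarrow> smooth \<phi> \<and> compact (closure {x. \<phi> x \<noteq> 0})"

definition locally_integrable :: "(real \<Rightarrow> real) \<Rightarrow> bool" where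
  "locally_integrable u \<longleftrightarrow> (\<forall>a b. set_integrable lborel {a..b} u)"

text \<open>The distributional derivative of \<open>u\<close> is the signed measure \<open>M - N\<close>, for locally finite
  Borel measures \<open>M\<close> and \<open>N\<close>.  A locally integrable function with such a derivative is in
  \<open>BV\<^sub>l\<^sub>o\<^sub>c\<close>.\<close>

definition has_distributional_derivative ::
    "(real \<Rightarrow> real) \<Rightarrow> real measure \<Rightarrow> real measure \<Rightarrow> bool" where
  "has_distributional_derivative u M N \<longleftrightarrow>
     (\<forall>\<phi>. test_function \<phi> \<longrightarrow>
        - (\<integral>x. u x * deriv \<phi> x \<partial>lborel) = (\<integral>x. \<phi> x \<partial>M) - (\<integral>x. \<phi> x \<partial>N))"

definition standard_mollifier :: "(real \<Rightarrow> real) \<Rightarrow> bool" where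
  "standard_mollifier \<rho> \<longleftrightarrow>
     smooth \<rho> \<and> (\<forall>x. 0 \<le> \<rho> x) \<and> (\<forall>x. \<rho> (- x) = \<rho> x) \<and>
     (\<forall>x. x \<notin> {-1<..<1} \<longrightarrow> \<rho> x = 0) \<and> (\<rho> has_integral 1) UNIV"

definition rescale :: "(real \<Rightarrow> real) \<Rightarrow> real \<Rightarrow> real \<Rightarrow> real" where
  "rescale \<rho> \<epsilon> x = (1 / \<epsilon>) * \<rho> (x / \<epsilon>)"

definition convolve :: "(real \<Rightarrow> real) \<Rightarrow> (real \<Rightarrow> real) \<Rightarrow> real \<Rightarrow> real" where
  "convolve f g x = (\<integral>y. f (x - y) * g y \<partial>lborel)"

definition configs :: "nat \<Rightarrow> (nat \<Rightarrow> real) set" where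
  "configs L = {1..L} \<rightarrow>\<^sub>E {0..<real L}"

text \<open>For \<open>L > 0\<close> the infimum over the integers is attained.\<close>

definition per_abs :: "nat \<Rightarrow> real \<Rightarrow> real" where
  "per_abs L t = (INF z::int. \<bar>t + real L * of_int z\<bar>)"

definition min_dist :: "nat \<Rightarrow> (nat \<Rightarrow> real) \<Rightarrow> real" where
  "min_dist L X =
     (if L = 1 then 1
      else Min {per_abs L (X i - X j) | i j. i \<in> {1..L} \<and> j \<in> {1..L} \<and> i \<noteq> j})"

text \<open>Only used for \<open>1/2 \<le> s < 1\<close> and \<open>\<delta> > 0\<close>.\<close>

definition \<sigma> :: "real \<Rightarrow> real \<Rightarrow> real" where
  "\<sigma> s \<delta> =
     (if s = 1/2 then \<bar>ln \<delta>\<bar>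
      else 2 powr (1 - 2 * s) / (2 * s * (2 * s - 1)) * \<delta> powr (1 - 2 * s))"

text \<open>The sum of the Dirac masses at \<open>X i + L * k\<close>, as the image of counting measure on the
  indices \<open>(i, k)\<close>, so that coinciding points are counted with multiplicity.\<close>

definition \<mu> :: "nat \<Rightarrow> (nat \<Rightarrow> real) \<Rightarrow> real measure" where
  "\<mu> L X = distr (count_space ({1..L} \<times> (UNIV :: int set))) borel
             (\<lambda>(i, k). X i + real L * of_int k)"

text \<open>The function is determined up to an additive constant and up to its values on a null set;
  neither affects the energy below.  Its periodicity (almost everywhere) is a consequence of its
  derivative.\<close>

definition u_of :: "nat \<Rightarrow> (nat \<Rightarrow> real) \<Rightarrow> real \<Rightarrow> real" where
  "u_of L X =
     (SOME u. locally_integrable u \<and> has_distributional_derivative u lborel (\<mu> L X))"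

definition u_eps :: "(real \<Rightarrow> real) \<Rightarrow> real \<Rightarrow> nat \<Rightarrow> (nat \<Rightarrow> real) \<Rightarrow> real \<Rightarrow> real" where
  "u_eps \<rho> \<epsilon> L X = convolve (rescale \<rho> \<epsilon>) (u_of L X)"

definition energy :: "(real \<Rightarrow> real) \<Rightarrow> real \<Rightarrow> real \<Rightarrow> nat \<Rightarrow> (nat \<Rightarrow> real) \<Rightarrow> ennreal" where
  "energy \<rho> s \<epsilon> L X =
     ennreal (1/2) *
     (\<integral>\<^sup>+ x \<in> {0..real L}.
        (\<integral>\<^sup>+ y. ennreal (\<bar>u_eps \<rho> \<epsilon> L X x - u_eps \<rho> \<epsilon> L X y\<bar>\<^sup>2 / \<bar>x - y\<bar> powr (1 + 2 * s)) \<partial>lborel)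
      \<partial>lborel)"

end

theory Submission
  imports Defs
begin

text \<open>For \<open>2 \<epsilon> \<le> t \<le> 1/4\<close> the increment of \<open>u_eps\<close> over \<open>[x, x + t]\<close> is at most \<open>2 t\<close> minus the mollified
  number of points in that interval, so once a point lies in the interval shrunk by \<open>\<epsilon>\<close> at both ends,
  its square is at least \<open>N\<^sup>2 - 4 t N\<close>, where \<open>N\<close> counts the points in the shrunk interval.  Now \<open>N\<^sup>2 \<ge> N\<close>,
  and \<open>N\<^sup>2 \<ge> N + 2\<close> when both members of a given pair lie there.  Averaging over \<open>x\<close> in a period, each
  point contributes \<open>t - 2 \<epsilon>\<close> and a pair at distance \<open>d\<close> contributes another
  \<open>2 (t - 2 \<epsilon> - d)\<close>.  Since \<open>\<sigma> s (r / 2)\<close> is up to a bounded error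
  the integral of \<open>t\<^bsup>-1-2s\<^esup> (t - r)\<close> over \<open>[r, 1/4]\<close>, the points give \<open>L \<sigma> s \<epsilon>\<close> and a close pair gives
  \<open>2 \<sigma> s \<delta>\<close>; half of the latter absorbs the bounded errors for small \<open>\<delta>\<close>, so that \<open>C = 1\<close> works.\<close>

subsection \<open>Smooth functions and mollifiers\<close>

lemma smooth_differentiable: "smooth f \<Longrightarrow> (deriv ^^ n) f differentiable at x"
  by (simp add: smooth_def differentiable_on_def)

lemma smooth_DERIV: "smooth f \<Longrightarrow> ((deriv ^^ n) f has_real_derivative (deriv ^^ Suc n) f x) (at x)"
  using smooth_differentiable[of f n x]
  by (simp add: DERIV_deriv_iff_real_differentiable)

lemma smooth_continuous: "smooth f \<Longrightarrow> continuous_on S f"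
  using smooth_DERIV[of f 0] by (auto intro!: continuous_at_imp_continuous_on intro: DERIV_isCont)

text \<open>Each differentiation only brings out a factor \<open>b\<close>, which gives a closed
  form for all iterates of \<open>deriv\<close>. Needed for the rescaled translates that make up the
  test functions in \<open>u_eps_diff\<close>.\<close>

lemma smooth_cmult_affine:
  assumes "smooth f"
  shows "smooth (\<lambda>x. a * f (b * x + c))"
proof -
  have D: "((\<lambda>x. a * b ^ n * (deriv ^^ n) f (b * x + c)) has_real_derivative
          a * b ^ Suc n * (deriv ^^ Suc n) f (b * x + c)) (at x)" for n x
    by (rule derivative_eq_intros DERIV_chain2[OF smooth_DERIV[OF assms]] refl)+ simp
  have "(deriv ^^ n) (\<lambda>x. a * f (b * x + c)) = (\<lambda>x. a * b ^ n * (deriv ^^ n) f (b * x + c))" for n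
  proof (induction n)
    case (Suc n)
    show ?case using DERIV_imp_deriv[OF D] by (simp add: Suc fun_eq_iff)
  qed simp
  then show ?thesis
    unfolding smooth_def using D by (auto simp: differentiable_on_def real_differentiable_def)
qed

lemma smooth_add:
  assumes "smooth f" "smooth g"
  shows "smooth (\<lambda>x. f x + g x)"
proof -
  have D: "((\<lambda>x. (deriv ^^ n) f x + (deriv ^^ n) g x) has_real_derivative
          (deriv ^^ Suc n) f x + (deriv ^^ Suc n) g x) (at x)" for n x
    by (intro DERIV_add smooth_DERIV assms)
  have "(deriv ^^ n) (\<lambda>x. f x + g x) = (\<lambda>x. (deriv ^^ n) f x + (deriv ^^ n) g x)" for n
  proof (induction n)
    case (Suc n)
    show ?case using DERIV_imp_deriv[OF D] by (simp add: Suc fun_eq_iff)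
  qed simp
  then show ?thesis
    unfolding smooth_def using D by (auto simp: differentiable_on_def real_differentiable_def)
qed

lemma smooth_primitive:
  assumes F: "\<And>x. (F has_real_derivative f x) (at x)" and "smooth f"
  shows "smooth F"
  unfolding smooth_def
proof
  fix n
  have "deriv F = f" using DERIV_imp_deriv[OF F] by auto
  then show "(deriv ^^ n) F differentiable_on UNIV"
    using F \<open>smooth f\<close>
    by (cases n) (auto simp: smooth_def funpow_Suc_right differentiable_on_def
        real_differentiable_def simp del: funpow.simps(2))
qed

text \<open>\<open>R\<close> is the cumulative distribution function of \<open>\<rho>\<close>. The
  differences \<open>R ((b - y) / \<epsilon>) - R ((a - y) / \<epsilon>)\<close> will serve as
  smoothed indicators of \<open>[a, b]\<close>.\<close>

lemma mollifier_primitive: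
  assumes "standard_mollifier \<rho>"
  obtains R where "\<And>x. (R has_real_derivative \<rho> x) (at x)" "mono R"
    "\<And>x. x \<le> -1 \<Longrightarrow> R x = 0" "\<And>x. x \<ge> 1 \<Longrightarrow> R x = 1"
proof -
  have \<rho>: "smooth \<rho>" "\<And>x. 0 \<le> \<rho> x" "\<And>x. x \<notin> {-1<..<1} \<Longrightarrow> \<rho> x = 0" "(\<rho> has_integral 1) UNIV"
    using assms unfolding standard_mollifier_def by blast+
  have cont: "continuous_on S \<rho>" for S using \<rho>(1) by (rule smooth_continuous)
  define R where "R x = (LBINT t=-1..x. \<rho> t)" for x :: real
  have R': "(R has_real_derivative \<rho> x) (at x)" for x
  proof -
    \<comment> \<open>Both -1 and \<open>x\<close> lie strictly inside \<open>{a..b}\<close>, so the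
      derivative within this interval is a derivative at \<open>x\<close>.\<close>
    define a b where "a = min (-1) x - 1" and "b = max (-1) x + 1"
    have "((\<lambda>u. LBINT t=-1..u. \<rho> t) has_vector_derivative \<rho> x) (at x within {a..b})"
      using interval_integral_FTC2[of a "-1" b \<rho> x] cont by (simp add: a_def b_def one_ereal_def)
    moreover have "at x within {a..b} = at x"
      by (rule at_within_interior) (auto simp: a_def b_def)
    ultimately show ?thesis
      unfolding R_def[abs_def] by (simp add: has_real_derivative_iff_has_vector_derivative)
  qed
  have mono: "mono R"
  proof (rule monoI)
    fix x y :: real
    assume "x \<le> y"
    then show "R x \<le> R y"
      by (rule DERIV_nonneg_imp_nondecreasing) (use R' \<rho>(2) in blast)
  qed
  \<comment> \<open>\<open>R\<close> is constant where \<open>\<rho>\<close> vanishes; this carries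
    the values at -1 and 1 to the outer half-lines.\<close>
  have const: "R x = R y" if "x \<le> y" "\<And>t. x \<le> t \<Longrightarrow> t \<le> y \<Longrightarrow> \<rho> t = 0" for x y
  proof (cases "x < y")
    case True
    have "(R has_real_derivative 0) (at t)" if "x < t" "t < y" for t
      using R'[of t] \<open>\<And>t. x \<le> t \<Longrightarrow> t \<le> y \<Longrightarrow> \<rho> t = 0\<close>[of t] that by simp
    moreover have "continuous_on {x..y} R"
      by (rule DERIV_continuous_on[OF has_field_derivative_at_within[OF R']])
    ultimately show ?thesis using DERIV_isconst_end[of x y R] True by simp
  qed (use that in simp)
  have "R (-1) = 0" by (simp add: R_def one_ereal_def)
  then have R0: "R x = 0" if "x \<le> -1" for x using const[of x "-1"] that \<rho>(3) by auto
  have "(\<rho> has_integral 1) {-1..1}"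
  proof -
    have "\<rho> = (\<lambda>x. if x \<in> {-1..1} then \<rho> x else 0)" using \<rho>(3) by fastforce
    with \<rho>(4) show ?thesis by (metis has_integral_restrict_UNIV)
  qed
  moreover have "R 1 = integral {-1..1} \<rho>"
    unfolding R_def using interval_integral_eq_integral[of "-1" 1 \<rho>]
    by (simp add: one_ereal_def borel_integrable_atLeastAtMost' cont)
  ultimately have "R 1 = 1" by (simp add: integral_unique)
  then have R1: "R x = 1" if "x \<ge> 1" for x using const[of 1 x] that \<rho>(3) by auto
  show thesis using that[OF R' mono R0 R1] .
qed

subsection \<open>Existence of \<open>u_of\<close>\<close>

lemma test_function_compact_support:
  assumes "test_function \<phi>"
  obtains r where "r > 0" "\<And>x. r \<le> \<bar>x\<bar> \<Longrightarrow> \<phi> x = 0" "\<And>x. r < \<bar>x\<bar> \<Longrightarrow> deriv \<phi> x = 0"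
proof -
  have "bounded {x. \<phi> x \<noteq> 0}"
    using assms unfolding test_function_def by (meson bounded_closure_image bounded_subset closure_subset compact_imp_bounded)
  then obtain B where B: "\<And>x. \<phi> x \<noteq> 0 \<Longrightarrow> \<bar>x\<bar> \<le> B"
    by (auto simp: bounded_iff)
  define r where "r = max B 0 + 1"
  have 0: "\<phi> x = 0" if "r \<le> \<bar>x\<bar>" for x using B[of x] that by (force simp: r_def)
  \<comment> \<open>The inequality is strict because the derivative is read off from an open set on
    which \<open>\<phi>\<close> vanishes.\<close>
  have "deriv \<phi> x = 0" if "r < \<bar>x\<bar>" for x
  proof (rule DERIV_imp_deriv)
    have "open {x. r < \<bar>x\<bar>}" by (intro open_Collect_less continuous_intros)
    then show "(\<phi> has_real_derivative 0) (at x)"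
      using 0 that by (intro has_field_derivative_transform_within_open[OF DERIV_const]) auto
  qed
  then show thesis using that[of r] 0 by (auto simp: r_def)
qed

text \<open>The counting measure on the indices reduces to a finite sum as soon as \<open>K\<close>
  contains every translation that can meet the support of \<open>f\<close>. Indices are summed
  rather than positions, so coinciding points keep their multiplicity.\<close>

lemma integral_\<mu>_eq_sum:
  fixes f :: "real \<Rightarrow> real"
  assumes "f \<in> borel_measurable borel" "finite K"
    and "\<And>i k. i \<in> {1..L} \<Longrightarrow> k \<notin> K \<Longrightarrow> f (X i + real L * of_int k) = 0"
  shows "(\<integral>x. f x \<partial>\<mu> L X) = (\<Sum>i\<in>{1..L}. \<Sum>k\<in>K. f (X i + real L * of_int k))"
proof -
  let ?g = "\<lambda>(i, k). f (X i + real L * of_int k)"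
  have sub: "{a \<in> {1..L} \<times> UNIV. ?g a \<noteq> 0} \<subseteq> {1..L} \<times> K"
    using assms(3) by (fastforce simp del: atLeastAtMost_iff)
  have "(\<integral>x. f x \<partial>\<mu> L X) = (\<integral>a. ?g a \<partial>count_space ({1..L} \<times> UNIV))"
    unfolding \<mu>_def by (rule trans[OF integral_distr]) (use assms(1) in \<open>auto simp: case_prod_unfold\<close>)
  also have "\<dots> = (\<Sum>a | a \<in> {1..L} \<times> UNIV \<and> ?g a \<noteq> 0. ?g a)"
    using finite_subset[OF sub] assms(2) by (intro lebesgue_integral_count_space_finite_support) auto
  also have "\<dots> = (\<Sum>a\<in>{1..L} \<times> K. ?g a)"
    using sub assms(2) by (intro sum.mono_neutral_left) auto
  finally show ?thesis by (simp add: sum.cartesian_product)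
qed

text \<open>Exactly \<open>\<lfloor>t\<rfloor> + M\<close> integers lie in
  \<open>{-M+1..\<lfloor>t\<rfloor>}\<close>. Locally this turns the floor function into a finite
  sum of unit steps, whose distributional derivatives are Dirac masses.\<close>

lemma of_int_floor_eq_sum:
  fixes t :: real
  assumes "\<bar>t\<bar> < of_int M"
  shows "of_int \<lfloor>t\<rfloor> = - of_int M + (\<Sum>k\<in>{-M+1..M}. of_bool (of_int k \<le> t) :: real)"
proof -
  have "{k \<in> {-M+1..M}. of_int k \<le> t} = {-M+1..\<lfloor>t\<rfloor>}"
    using assms by (auto simp: le_floor_iff)
  moreover have "- M \<le> \<lfloor>t\<rfloor>" using assms by (simp add: le_floor_iff)
  ultimately show ?thesis
    by (simp add: of_bool_def sum.If_cases Int_def)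
qed

text \<open>The fundamental theorem on the half-line from \<open>q\<close>: the distributional
  derivative of a unit step at \<open>q\<close> is the Dirac mass at \<open>q\<close>.\<close>

lemma integral_step_deriv:
  assumes "test_function \<phi>"
  shows "has_bochner_integral lborel (\<lambda>x. indicator {q..} x * deriv \<phi> x) (- \<phi> q)"
proof -
  have sm: "smooth \<phi>" using assms by (simp add: test_function_def)
  obtain r where r: "r > 0" "\<And>x. r \<le> \<bar>x\<bar> \<Longrightarrow> \<phi> x = 0" "\<And>x. r < \<bar>x\<bar> \<Longrightarrow> deriv \<phi> x = 0"
    using test_function_compact_support[OF assms] by metis
  \<comment> \<open>To the right of both \<open>q\<close> and the support, so
    \<open>\<phi> b = 0\<close> and the half-line may be cut off at \<open>b\<close>.\<close>
  define b where "b = max q r + 1"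
  have "has_bochner_integral lborel (\<lambda>x. deriv \<phi> x * indicator {q..b} x) (\<phi> b - \<phi> q)"
  proof (rule has_bochner_integral_FTC_Icc_real)
    show "(\<phi> has_real_derivative deriv \<phi> x) (at x)" for x using smooth_DERIV[OF sm, of 0] by simp
    show "isCont (deriv \<phi>) x" for x using smooth_DERIV[OF sm, of 1] by (auto intro: DERIV_isCont)
  qed (simp add: b_def)
  also have "(\<lambda>x. deriv \<phi> x * indicator {q..b} x) = (\<lambda>x. indicator {q..} x * deriv \<phi> x)"
  proof (rule ext)
    show "deriv \<phi> x * indicator {q..b} x = indicator {q..} x * deriv \<phi> x" for x
      using r(3)[of x] by (cases "r < \<bar>x\<bar>") (auto simp: indicator_def b_def)
  qed
  finally show ?thesis using r(2)[of b] by (simp add: b_def)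
qed

text \<open>A step placed to the left of the support equals 1 wherever \<open>deriv \<phi>\<close>
  is nonzero.\<close>

lemma integral_deriv_zero:
  assumes "test_function \<phi>"
  shows "has_bochner_integral lborel (deriv \<phi>) 0"
proof -
  obtain r where r: "r > 0" "\<And>x. r \<le> \<bar>x\<bar> \<Longrightarrow> \<phi> x = 0" "\<And>x. r < \<bar>x\<bar> \<Longrightarrow> deriv \<phi> x = 0"
    using test_function_compact_support[OF assms] by metis
  have "(\<lambda>x. indicator {-r-1..} x * deriv \<phi> x) = (\<lambda>x. deriv \<phi> x)"
  proof (rule ext)
    show "indicator {-r-1..} x * deriv \<phi> x = deriv \<phi> x" for x
      using r(3)[of x] by (cases "r < \<bar>x\<bar>") (auto simp: indicator_def)
  qed
  then show ?thesis using integral_step_deriv[OF assms, of "-r-1"] r(1,2) by simp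
qed

text \<open>Integration by parts: the derivative of \<open>x * \<phi> x\<close> integrates to
  boundary values, which vanish outside the support.\<close>

lemma integral_id_deriv:
  assumes "test_function \<phi>"
  shows "has_bochner_integral lborel (\<lambda>x. x * deriv \<phi> x) (- (\<integral>x. \<phi> x \<partial>lborel))"
proof -
  have sm: "smooth \<phi>" using assms by (simp add: test_function_def)
  obtain r where r: "r > 0" "\<And>x. r \<le> \<bar>x\<bar> \<Longrightarrow> \<phi> x = 0" "\<And>x. r < \<bar>x\<bar> \<Longrightarrow> deriv \<phi> x = 0"
    using test_function_compact_support[OF assms] by metis
  have D: "(\<phi> has_real_derivative deriv \<phi> x) (at x)" for x using smooth_DERIV[OF sm, of 0] by simp
  have C: "isCont (deriv \<phi>) x" "isCont \<phi> x" for x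
    using smooth_DERIV[OF sm, of 1] D by (auto intro: DERIV_isCont)
  have "has_bochner_integral lborel (\<lambda>x. (x * deriv \<phi> x + \<phi> x) * indicator {-r-1..r+1} x)
          ((r + 1) * \<phi> (r + 1) - (-r-1) * \<phi> (-r-1))"
    by (rule has_bochner_integral_FTC_Icc_real)
       (use r(1) in \<open>auto intro!: derivative_eq_intros D continuous_intros C\<close>)
  also have "(\<lambda>x. (x * deriv \<phi> x + \<phi> x) * indicator {-r-1..r+1} x) = (\<lambda>x. x * deriv \<phi> x + \<phi> x)"
  proof (rule ext)
    show "(x * deriv \<phi> x + \<phi> x) * indicator {-r-1..r+1} x = x * deriv \<phi> x + \<phi> x" for x
      using r(2,3)[of x] by (cases "r < \<bar>x\<bar>") (auto simp: indicator_def)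
  qed
  finally have "has_bochner_integral lborel (\<lambda>x. x * deriv \<phi> x + \<phi> x) 0"
    using r(1,2) by simp
  moreover have "integrable lborel \<phi>"
  proof -
    have "integrable lborel (\<lambda>x. \<phi> x * indicator {-r-1..r+1} x)"
      by (intro borel_integrable_atLeastAtMost C)
    also have "(\<lambda>x. \<phi> x * indicator {-r-1..r+1} x) = (\<lambda>x. \<phi> x)"
    proof (rule ext)
      show "\<phi> x * indicator {-r-1..r+1} x = \<phi> x" for x
        using r(2)[of x] by (cases "r < \<bar>x\<bar>") (auto simp: indicator_def)
    qed
    finally show ?thesis .
  qed
  ultimately have "has_bochner_integral lborel (\<lambda>x. (x * deriv \<phi> x + \<phi> x) - \<phi> x) (0 - (\<integral>x. \<phi> x \<partial>lborel))"
    by (intro has_bochner_integral_diff has_bochner_integral_integrable)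
  then show ?thesis by simp
qed

text \<open>The witness is a sawtooth: slope 1, and a drop by 1 at each \<open>X i + L * k\<close>
  for every index \<open>i\<close>. Since \<open>u_of\<close> is a choice, nothing can be said about
  it before some such function is exhibited.\<close>

lemma u_of_exists:
  assumes "L \<ge> 1"
  shows "\<exists>u. locally_integrable u \<and> has_distributional_derivative u lborel (\<mu> L X)"
proof (intro exI conjI)
  define fl where "fl i x = (of_int \<lfloor>(x - X i) / real L\<rfloor> :: real)" for i x
  define u where "u x = x - (\<Sum>i\<in>{1..L}. fl i x)" for x
  have fl_meas[measurable]: "fl i \<in> borel_measurable borel" for i
    unfolding fl_def[abs_def] by measurable
  show "locally_integrable u"
    unfolding locally_integrable_def
  proof (intro allI)
    fix a b :: real
    have fl: "set_integrable lborel {a..b} (fl i)" for i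
    proof (rule set_integrable_bound)
      let ?B = "(\<bar>a\<bar> + \<bar>b\<bar> + \<bar>X i\<bar>) / real L + 1"
      show "set_integrable lborel {a..b} (\<lambda>_. ?B)"
        by (rule borel_integrable_atLeastAtMost') (intro continuous_intros)
      show "set_borel_measurable lborel {a..b} (fl i)"
        unfolding set_borel_measurable_def by measurable
      have "\<bar>fl i x\<bar> \<le> ?B" if "a \<le> x" "x \<le> b" for x
      proof -
        have "\<bar>fl i x\<bar> \<le> \<bar>(x - X i) / real L\<bar> + 1" unfolding fl_def by linarith
        also have "\<bar>(x - X i) / real L\<bar> \<le> (\<bar>a\<bar> + \<bar>b\<bar> + \<bar>X i\<bar>) / real L"
          using that assms by (simp add: abs_divide divide_right_mono)
        finally show ?thesis by simp
      qed
      then show "AE x in lborel. x \<in> {a..b} \<longrightarrow> norm (fl i x) \<le> norm ?B"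
        by (intro AE_I2) (auto intro: order_trans)
    qed
    have "set_integrable lborel {a..b} (\<lambda>x. x)"
      by (rule borel_integrable_atLeastAtMost') (intro continuous_intros)
    then show "set_integrable lborel {a..b} u"
      using fl unfolding u_def[abs_def] set_integrable_def scaleR_diff_right scaleR_right.sum
      by (intro Bochner_Integration.integrable_diff Bochner_Integration.integrable_sum)
  qed
  show "has_distributional_derivative u lborel (\<mu> L X)"
    unfolding has_distributional_derivative_def
  proof (intro allI impI)
    fix \<phi> assume \<phi>: "test_function \<phi>"
    then have sm: "smooth \<phi>" by (simp add: test_function_def)
    obtain r where r: "r > 0" "\<And>x. r \<le> \<bar>x\<bar> \<Longrightarrow> \<phi> x = 0" "\<And>x. r < \<bar>x\<bar> \<Longrightarrow> deriv \<phi> x = 0"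
      using test_function_compact_support[OF \<phi>] by metis
    \<comment> \<open>One cutoff for all \<open>i\<close>: on the support of \<open>\<phi>\<close>
      the floor arguments stay below \<open>M\<close> in absolute value, and translates with index
      outside \<open>{-M+1..M}\<close> miss the support.\<close>
    define M where "M = \<lceil>r + (\<Sum>i\<in>{1..L}. \<bar>X i\<bar>)\<rceil> + 1"
    have M: "r + \<bar>X i\<bar> < of_int M" if "i \<in> {1..L}" for i
    proof -
      have "\<bar>X i\<bar> \<le> (\<Sum>i\<in>{1..L}. \<bar>X i\<bar>)" using that by (intro member_le_sum) auto
      then show ?thesis unfolding M_def by linarith
    qed
    \<comment> \<open>The term \<open>- of_int M * 0\<close> is the constant part of the floor
      expansion, tested against a derivative of integral zero.\<close>
    have fl_int: "has_bochner_integral lborel (\<lambda>x. fl i x * deriv \<phi> x)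
           (- of_int M * 0 + (\<Sum>k\<in>{-M+1..M}. - \<phi> (X i + real L * of_int k)))"
      if i: "i \<in> {1..L}" for i
    proof -
      have "fl i x * deriv \<phi> x = - of_int M * deriv \<phi> x
              + (\<Sum>k\<in>{-M+1..M}. indicator {X i + real L * of_int k..} x * deriv \<phi> x)" for x
      proof (cases "r < \<bar>x\<bar>")
        case False
        \<comment> \<open>On the support, \<open>L \<ge> 1\<close> makes division by
          \<open>L\<close> harmless, so the expansion into steps applies.\<close>
        have "\<bar>(x - X i) / real L\<bar> \<le> \<bar>x - X i\<bar>"
          using assms by (simp add: abs_divide divide_le_eq mult_le_cancel_left1)
        also have "\<dots> < of_int M" using M[OF i] False by linarith
        finally have "fl i x = - of_int M + (\<Sum>k\<in>{-M+1..M}. of_bool (of_int k \<le> (x - X i) / real L))"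
          unfolding fl_def by (rule of_int_floor_eq_sum)
        also have "(\<Sum>k\<in>{-M+1..M}. of_bool (of_int k \<le> (x - X i) / real L)) =
            (\<Sum>k\<in>{-M+1..M}. indicator {X i + real L * of_int k..} x :: real)"
          using assms by (intro sum.cong) (auto simp: indicator_def field_simps)
        finally show ?thesis by (simp only: distrib_right sum_distrib_right)
      qed (simp add: r(3))
      then show ?thesis
        by (simp only:) (intro has_bochner_integral_add has_bochner_integral_sum
            has_bochner_integral_mult_right integral_deriv_zero integral_step_deriv \<phi>)
    qed
    have "has_bochner_integral lborel (\<lambda>x. x * deriv \<phi> x - (\<Sum>i\<in>{1..L}. fl i x * deriv \<phi> x))
       (- (\<integral>x. \<phi> x \<partial>lborel) - (\<Sum>i\<in>{1..L}. - of_int M * 0 + (\<Sum>k\<in>{-M+1..M}. - \<phi> (X i + real L * of_int k))))"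
      by (intro has_bochner_integral_diff integral_id_deriv has_bochner_integral_sum fl_int \<phi>)
    then have "(\<integral>x. u x * deriv \<phi> x \<partial>lborel) =
       - (\<integral>x. \<phi> x \<partial>lborel) + (\<Sum>i\<in>{1..L}. \<Sum>k\<in>{-M+1..M}. \<phi> (X i + real L * of_int k))"
      unfolding u_def
      by (subst has_bochner_integral_integral_eq)
         (simp_all add: left_diff_distrib sum_distrib_right sum_negf has_bochner_integral_iff)
    moreover have "(\<integral>x. \<phi> x \<partial>\<mu> L X) = (\<Sum>i\<in>{1..L}. \<Sum>k\<in>{-M+1..M}. \<phi> (X i + real L * of_int k))"
    proof (rule integral_\<mu>_eq_sum)
      show "\<phi> \<in> borel_measurable borel"
        using smooth_continuous[OF sm] by (rule borel_measurable_continuous_onI)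
      fix i k assume i: "i \<in> {1..L}" and "k \<notin> {-M+1..M}"
      then have "of_int M \<le> \<bar>of_int k :: real\<bar>" by force
      also have "\<dots> \<le> \<bar>real L * of_int k\<bar>" using assms by (simp add: abs_mult mult_le_cancel_right1)
      finally show "\<phi> (X i + real L * of_int k) = 0" using M[OF i] by (intro r(2)) linarith
    qed simp
    ultimately show "- (\<integral>x. u x * deriv \<phi> x \<partial>lborel) = (\<integral>x. \<phi> x \<partial>lborel) - (\<integral>x. \<phi> x \<partial>\<mu> L X)"
      by simp
  qed
qed

subsection \<open>Increments of \<open>u_eps\<close>\<close>

lemma rescale_eq_zero: "standard_mollifier \<rho> \<Longrightarrow> \<epsilon> > 0 \<Longrightarrow> \<epsilon> \<le> \<bar>x\<bar> \<Longrightarrow> rescale \<rho> \<epsilon> x = 0"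
  by (auto simp: standard_mollifier_def rescale_def field_simps abs_if split: if_splits)

lemma rescale_continuous:
  assumes "standard_mollifier \<rho>" "\<epsilon> > 0"
  shows "continuous_on S (\<lambda>y. rescale \<rho> \<epsilon> (a - y))"
proof -
  have "continuous_on UNIV \<rho>"
    using assms by (intro smooth_continuous) (simp add: standard_mollifier_def)
  then have "continuous_on S (\<lambda>y. \<rho> ((a - y) / \<epsilon>))"
    by (rule continuous_on_compose2) (use assms(2) in \<open>auto intro!: continuous_intros\<close>)
  then show ?thesis unfolding rescale_def by (intro continuous_on_mult_left)
qed

text \<open>The mollifier is bounded and vanishes outside a compact interval, on which
  \<open>u\<close> is integrable.\<close>

lemma integrable_rescale_mult:
  assumes "standard_mollifier \<rho>" "\<epsilon> > 0" "locally_integrable u"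
  shows "integrable lborel (\<lambda>y. rescale \<rho> \<epsilon> (a - y) * u y)"
proof -
  have "compact ((\<lambda>y. rescale \<rho> \<epsilon> (a - y)) ` {a-\<epsilon>..a+\<epsilon>})"
    using rescale_continuous[OF assms(1,2)] by (intro compact_continuous_image) auto
  then obtain B where B: "\<And>y. y \<in> {a-\<epsilon>..a+\<epsilon>} \<Longrightarrow> \<bar>rescale \<rho> \<epsilon> (a - y)\<bar> \<le> B"
    by (force dest!: compact_imp_bounded simp: bounded_iff)
  have [measurable]: "(\<lambda>y. rescale \<rho> \<epsilon> (a - y)) \<in> borel_measurable borel"
    using rescale_continuous[OF assms(1,2)] by (intro borel_measurable_continuous_onI)
  have int: "integrable lborel (\<lambda>y. indicator {a-\<epsilon>..a+\<epsilon>} y * u y)"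
    using assms(3) by (simp add: locally_integrable_def set_integrable_def)
  have [measurable]: "(\<lambda>y. indicator {a-\<epsilon>..a+\<epsilon>} y * u y) \<in> borel_measurable lborel"
    using int by (rule borel_measurable_integrable)
  have "integrable lborel (\<lambda>y. rescale \<rho> \<epsilon> (a - y) * (indicator {a-\<epsilon>..a+\<epsilon>} y * u y))"
  proof (rule Bochner_Integration.integrable_bound)
    show "integrable lborel (\<lambda>y. B * (indicator {a-\<epsilon>..a+\<epsilon>} y * u y))"
      using int by (intro integrable_mult_right)
    show "AE y in lborel. norm (rescale \<rho> \<epsilon> (a - y) * (indicator {a-\<epsilon>..a+\<epsilon>} y * u y))
        \<le> norm (B * (indicator {a-\<epsilon>..a+\<epsilon>} y * u y))"
    proof (rule AE_I2)
      show "norm (rescale \<rho> \<epsilon> (a - y) * (indicator {a-\<epsilon>..a+\<epsilon>} y * u y))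
        \<le> norm (B * (indicator {a-\<epsilon>..a+\<epsilon>} y * u y))" for y
        using B[of y] by (auto simp: indicator_def abs_mult intro!: mult_right_mono)
    qed
  qed measurable
  also have "(\<lambda>y. rescale \<rho> \<epsilon> (a - y) * (indicator {a-\<epsilon>..a+\<epsilon>} y * u y)) = (\<lambda>y. rescale \<rho> \<epsilon> (a - y) * u y)"
  proof (rule ext)
    show "rescale \<rho> \<epsilon> (a - y) * (indicator {a-\<epsilon>..a+\<epsilon>} y * u y) = rescale \<rho> \<epsilon> (a - y) * u y" for y
      using rescale_eq_zero[OF assms(1,2), of "a - y"]
      by (cases "\<epsilon> \<le> \<bar>a - y\<bar>") (auto simp: indicator_def)
  qed
  finally show ?thesis .
qed

text \<open>The increment of \<open>u_eps\<close> tests the distributional derivative of \<open>u\<close> against a smoothed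
  indicator of \<open>[a, b]\<close>; hence it does not depend on the choice made in \<open>u_of\<close>.\<close>

lemma u_eps_diff:
  fixes a b :: real
  assumes \<rho>: "standard_mollifier \<rho>" and \<epsilon>: "\<epsilon> > 0" and L: "L \<ge> 1"
    and R: "\<And>x. (R has_real_derivative \<rho> x) (at x)"
      "\<And>x. x \<le> -1 \<Longrightarrow> R x = 0" "\<And>x. x \<ge> 1 \<Longrightarrow> R x = 1"
  defines "\<phi> \<equiv> \<lambda>y. R ((b - y) / \<epsilon>) - R ((a - y) / \<epsilon>)"
  shows "u_eps \<rho> \<epsilon> L X b - u_eps \<rho> \<epsilon> L X a = (\<integral>y. \<phi> y \<partial>lborel) - (\<integral>y. \<phi> y \<partial>\<mu> L X)"
proof -
  define u where "u = u_of L X"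
  have u: "locally_integrable u" "has_distributional_derivative u lborel (\<mu> L X)"
    using someI_ex[OF u_of_exists[OF L, of X]] by (simp_all add: u_def u_of_def)
  have smR: "smooth R" by (rule smooth_primitive[OF R(1)]) (use \<rho> in \<open>simp add: standard_mollifier_def\<close>)
  have "test_function \<phi>"
    unfolding test_function_def
  proof
    have "smooth (\<lambda>y. 1 * R ((- 1 / \<epsilon>) * y + b / \<epsilon>) + (-1) * R ((- 1 / \<epsilon>) * y + a / \<epsilon>))"
      by (intro smooth_add smooth_cmult_affine smR)
    also have "(\<lambda>y. 1 * R ((- 1 / \<epsilon>) * y + b / \<epsilon>) + (-1) * R ((- 1 / \<epsilon>) * y + a / \<epsilon>)) = \<phi>"
      by (simp add: \<phi>_def fun_eq_iff diff_divide_distrib)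
    finally show "smooth \<phi>" .
    have "{y. \<phi> y \<noteq> 0} \<subseteq> {- \<bar>a\<bar> - \<bar>b\<bar> - \<epsilon>..\<bar>a\<bar> + \<bar>b\<bar> + \<epsilon>}"
    proof safe
      fix y assume y: "\<phi> y \<noteq> 0"
      have "\<phi> y = 0" if "\<bar>a\<bar> + \<bar>b\<bar> + \<epsilon> < y"
        using that \<epsilon> R(2)[of "(b - y) / \<epsilon>"] R(2)[of "(a - y) / \<epsilon>"]
        by (auto simp: \<phi>_def field_simps)
      moreover have "\<phi> y = 0" if "y < - \<bar>a\<bar> - \<bar>b\<bar> - \<epsilon>"
        using that \<epsilon> R(3)[of "(b - y) / \<epsilon>"] R(3)[of "(a - y) / \<epsilon>"]
        by (auto simp: \<phi>_def field_simps)
      ultimately show "y \<in> {- \<bar>a\<bar> - \<bar>b\<bar> - \<epsilon>..\<bar>a\<bar> + \<bar>b\<bar> + \<epsilon>}"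
        using y by force
    qed
    then show "compact (closure {y. \<phi> y \<noteq> 0})"
      unfolding compact_closure by (rule bounded_subset[OF bounded_closed_interval])
  qed
  \<comment> \<open>The chain rule gives a difference of two mollifiers, centred at \<open>a\<close>
    and \<open>b\<close>, so pairing it with \<open>u\<close> produces the two convolutions.\<close>
  have deriv: "deriv \<phi> y = rescale \<rho> \<epsilon> (a - y) - rescale \<rho> \<epsilon> (b - y)" for y
  proof (rule DERIV_imp_deriv)
    have "((\<lambda>y. (c - y) / \<epsilon>) has_real_derivative - (1 / \<epsilon>)) (at y)" for c
      using \<epsilon> by (auto intro!: derivative_eq_intros)
    then have "((\<lambda>y. R ((c - y) / \<epsilon>)) has_real_derivative \<rho> ((c - y) / \<epsilon>) * - (1 / \<epsilon>)) (at y)" for c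
      by (rule DERIV_chain2[OF R(1)])
    from DERIV_diff[OF this this]
    show "(\<phi> has_real_derivative rescale \<rho> \<epsilon> (a - y) - rescale \<rho> \<epsilon> (b - y)) (at y)"
      by (simp add: \<phi>_def rescale_def)
  qed
  from \<open>test_function \<phi>\<close> u(2) have "(\<integral>y. \<phi> y \<partial>lborel) - (\<integral>y. \<phi> y \<partial>\<mu> L X) = - (\<integral>y. u y * deriv \<phi> y \<partial>lborel)"
    by (simp add: has_distributional_derivative_def)
  also have "- (\<integral>y. u y * deriv \<phi> y \<partial>lborel) =
      - (\<integral>y. rescale \<rho> \<epsilon> (a - y) * u y - rescale \<rho> \<epsilon> (b - y) * u y \<partial>lborel)"
    by (simp add: deriv right_diff_distrib mult.commute)
  also have "\<dots> = convolve (rescale \<rho> \<epsilon>) u b - convolve (rescale \<rho> \<epsilon>) u a"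
    unfolding convolve_def
    by (subst Bochner_Integration.integral_diff) (auto intro!: integrable_rescale_mult \<rho> \<epsilon> u(1))
  finally show ?thesis by (simp add: u_eps_def u_def)
qed

section \<open>Squared increments bounded below by counts of points\<close>

text \<open>A set of indices, so that coinciding entries of \<open>X\<close> are counted separately;
  an index with several translates in \<open>S\<close> counts once, which suffices for lower
  bounds.\<close>

definition points_hit :: "nat \<Rightarrow> (nat \<Rightarrow> real) \<Rightarrow> real set \<Rightarrow> nat set" where
  "points_hit L X S = {i \<in> {1..L}. \<exists>k::int. X i + real L * of_int k \<in> S}"

lemma finite_points_hit [simp]: "finite (points_hit L X S)"
  by (simp add: points_hit_def)

text \<open>The increment is \<open>m - S\<close>, with \<open>m\<close> the Lebesgue integral of a
  smoothed indicator and \<open>S\<close> its integral against the points. With \<open>N\<close>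
  points hit and \<open>h = b - a\<close>, \<open>S \<ge> N\<close> and
  \<open>m \<le> 2 * h \<le> 1/2\<close>. For \<open>N \<ge> 1\<close> this gives \<open>(S -
  m)\<^sup>2 \<ge> (N - m)\<^sup>2 \<ge> N\<^sup>2 - 4 * h * N\<close>; for \<open>N = 0\<close> the
  bound is trivial.\<close>

lemma u_eps_diff_sq_ge:
  fixes a b :: real
  assumes \<rho>: "standard_mollifier \<rho>" and \<epsilon>: "\<epsilon> > 0" and L: "L \<ge> 1"
    and ab: "2 * \<epsilon> \<le> b - a" "b - a \<le> 1/4"
  shows "(real (card (points_hit L X {a+\<epsilon>..b-\<epsilon>})))\<^sup>2 - 4 * (b - a) * card (points_hit L X {a+\<epsilon>..b-\<epsilon>})
    \<le> (u_eps \<rho> \<epsilon> L X b - u_eps \<rho> \<epsilon> L X a)\<^sup>2"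
proof -
  obtain R where R: "\<And>x. (R has_real_derivative \<rho> x) (at x)" "mono R"
    "\<And>x. x \<le> -1 \<Longrightarrow> R x = 0" "\<And>x. x \<ge> 1 \<Longrightarrow> R x = 1"
    using mollifier_primitive[OF \<rho>] by metis
  define \<phi> where "\<phi> y = R ((b - y) / \<epsilon>) - R ((a - y) / \<epsilon>)" for y
  have D: "u_eps \<rho> \<epsilon> L X b - u_eps \<rho> \<epsilon> L X a = (\<integral>y. \<phi> y \<partial>lborel) - (\<integral>y. \<phi> y \<partial>\<mu> L X)"
    using u_eps_diff[OF \<rho> \<epsilon> L R(1,3,4)] unfolding \<phi>_def[abs_def] by blast
  have R01: "0 \<le> R x" "R x \<le> 1" for x
    using monoD[OF R(2), of "min x (-1)" x] monoD[OF R(2), of x "max x 1"] R(3)[of "min x (-1)"]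
      R(4)[of "max x 1"] by auto
  have \<phi>01: "0 \<le> \<phi> y" "\<phi> y \<le> 1" for y
    using monoD[OF R(2), of "(a - y) / \<epsilon>" "(b - y) / \<epsilon>"] ab \<epsilon> R01(1)[of "(a - y) / \<epsilon>"] R01(2)[of "(b - y) / \<epsilon>"]
    by (auto simp: \<phi>_def divide_right_mono)
  have \<phi>_one: "\<phi> y = 1" if "y \<in> {a+\<epsilon>..b-\<epsilon>}" for y
    using that \<epsilon> R(3)[of "(a - y) / \<epsilon>"] R(4)[of "(b - y) / \<epsilon>"] by (auto simp: \<phi>_def field_simps)
  have \<phi>_zero: "\<phi> y = 0" if "y \<notin> {a-\<epsilon>..b+\<epsilon>}" for y
  proof (cases "y < a - \<epsilon>")
    case True
    then show ?thesis using ab \<epsilon> R(4)[of "(a - y) / \<epsilon>"] R(4)[of "(b - y) / \<epsilon>"]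
      by (auto simp: \<phi>_def field_simps)
  next
    case False
    then show ?thesis using that ab \<epsilon> R(3)[of "(a - y) / \<epsilon>"] R(3)[of "(b - y) / \<epsilon>"]
      by (auto simp: \<phi>_def field_simps)
  qed
  have "continuous_on UNIV R" by (rule DERIV_continuous_on[OF has_field_derivative_at_within[OF R(1)]])
  then have "continuous_on UNIV (\<lambda>y. R ((c - y) / \<epsilon>))" for c
    by (rule continuous_on_compose2) (use \<epsilon> in \<open>auto intro!: continuous_intros\<close>)
  then have "continuous_on UNIV \<phi>"
    unfolding \<phi>_def[abs_def] by (intro continuous_on_diff)
  then have [measurable]: "\<phi> \<in> borel_measurable borel" by (rule borel_measurable_continuous_onI)
  let ?h = "b - a"
  \<comment> \<open>The support has length at most \<open>?h + 2 * \<epsilon>\<close>, hence at most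
    \<open>2 * ?h\<close> because \<open>2 * \<epsilon> \<le> b - a\<close>.\<close>
  have "(\<integral>y. \<phi> y \<partial>lborel) \<le> (\<integral>y. indicator {a-\<epsilon>..b+\<epsilon>} y \<partial>lborel)"
    using \<phi>01 \<phi>_zero ab \<epsilon>
    by (intro integral_mono' integrable_real_indicator) (auto simp: indicator_def)
  then have int_le: "(\<integral>y. \<phi> y \<partial>lborel) \<le> 2 * ?h" using ab \<epsilon> by simp
  define H where "H = points_hit L X {a+\<epsilon>..b-\<epsilon>}"
  have "card H \<le> (\<integral>y. \<phi> y \<partial>\<mu> L X)"
  proof -
    define M where "M = \<lceil>\<bar>a\<bar> + \<bar>b\<bar> + \<epsilon> + (\<Sum>i\<in>{1..L}. \<bar>X i\<bar>)\<rceil> + 1"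
    have zero: "\<phi> (X i + real L * of_int k) = 0" if i: "i \<in> {1..L}" and "k \<notin> {-M..M}" for i k
    proof -
      from that have "of_int M < \<bar>of_int k :: real\<bar>" by force
      also have "\<dots> \<le> \<bar>real L * of_int k\<bar>" using L by (simp add: abs_mult mult_le_cancel_right1)
      finally have "of_int M < \<bar>real L * of_int k\<bar>" .
      moreover have "\<bar>X i\<bar> \<le> (\<Sum>i\<in>{1..L}. \<bar>X i\<bar>)" using i by (intro member_le_sum) auto
      ultimately show ?thesis by (intro \<phi>_zero) (auto simp: M_def, linarith+)
    qed
    have "(\<integral>y. \<phi> y \<partial>\<mu> L X) = (\<Sum>i\<in>{1..L}. \<Sum>k\<in>{-M..M}. \<phi> (X i + real L * of_int k))"
      by (rule integral_\<mu>_eq_sum) (use zero in auto)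
    \<comment> \<open>Each hit index has a translate at which \<open>\<phi>\<close> equals 1; all
      other terms are nonnegative and are dropped.\<close>
    moreover have "(\<Sum>i\<in>H. 1) \<le> (\<Sum>i\<in>H. \<Sum>k\<in>{-M..M}. \<phi> (X i + real L * of_int k))"
    proof (rule sum_mono)
      fix i assume "i \<in> H"
      then obtain k :: int where k: "i \<in> {1..L}" "\<phi> (X i + real L * of_int k) = 1"
        using \<phi>_one by (auto simp: H_def points_hit_def)
      then have "k \<in> {-M..M}" using zero by force
      then have "\<phi> (X i + real L * of_int k) \<le> (\<Sum>k\<in>{-M..M}. \<phi> (X i + real L * of_int k))"
        using \<phi>01 by (intro member_le_sum) auto
      with k show "1 \<le> (\<Sum>k\<in>{-M..M}. \<phi> (X i + real L * of_int k))" by simp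
    qed
    moreover have "\<dots> \<le> (\<Sum>i\<in>{1..L}. \<Sum>k\<in>{-M..M}. \<phi> (X i + real L * of_int k))"
      by (intro sum_mono2 sum_nonneg \<phi>01) (auto simp: H_def points_hit_def)
    ultimately show ?thesis by simp
  qed
  moreover define m where "m = (\<integral>y. \<phi> y \<partial>lborel)"
  moreover define S where "S = (\<integral>y. \<phi> y \<partial>\<mu> L X)"
  ultimately have S: "card H \<le> S" by simp
  have m: "0 \<le> m" "m \<le> 2 * ?h" using int_le \<phi>01 by (auto simp: m_def)
  have "(real (card H))\<^sup>2 - 4 * ?h * card H \<le> (m - S)\<^sup>2"
  proof (cases "card H = 0")
    case False
    then have "1 \<le> real (card H)" by linarith
    then have "(card H - m)\<^sup>2 \<le> (S - m)\<^sup>2"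
      using S m ab by (intro power_mono) auto
    moreover have "m * card H \<le> 2 * ?h * card H" using m by (intro mult_right_mono) auto
    moreover have "(card H - m)\<^sup>2 = (real (card H))\<^sup>2 - 2 * (m * card H) + m\<^sup>2"
      by (simp add: power2_eq_square algebra_simps)
    ultimately show ?thesis
      using zero_le_power2[of m] unfolding power2_commute[of m S] by linarith
  qed simp
  then show ?thesis unfolding D S_def m_def H_def .
qed

text \<open>The count is a natural number, so its square dominates a sum of indicators of single
  points and of one pair. Such a sum can be averaged over the position of the window point by point,
  without knowledge of the rest of the configuration.\<close>

lemma u_eps_diff_sq_ge_pair:
  fixes a b :: real and X :: "nat \<Rightarrow> real"
  assumes \<rho>: "standard_mollifier \<rho>" and \<epsilon>: "\<epsilon> > 0" and L: "L \<ge> 1"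
    and ab: "2 * \<epsilon> \<le> b - a" "b - a \<le> 1/4" and ij: "i \<noteq> j"
  defines "H \<equiv> points_hit L X {a+\<epsilon>..b-\<epsilon>}"
  shows "(1 - 4 * (b - a)) * card H + 2 * of_bool (i \<in> H \<and> j \<in> H)
    \<le> (u_eps \<rho> \<epsilon> L X b - u_eps \<rho> \<epsilon> L X a)\<^sup>2"
proof -
  have "card H + 2 * of_bool (i \<in> H \<and> j \<in> H) \<le> card H * card H"
  proof (cases "i \<in> H \<and> j \<in> H")
    case True
    then have "card {i, j} \<le> card H" by (intro card_mono) (auto simp: H_def)
    then have "2 \<le> card H" using ij by simp
    then have "2 * card H \<le> card H * card H" by (rule mult_right_mono) simp
    with \<open>2 \<le> card H\<close> have "card H + 2 \<le> card H * card H" by linarith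
    then show ?thesis using True by simp
  next
    case False
    then have "of_bool (i \<in> H \<and> j \<in> H) = (0::nat)" by simp
    then show ?thesis by (simp only:) simp
  qed
  then have "real (card H + 2 * of_bool (i \<in> H \<and> j \<in> H)) \<le> real (card H * card H)"
    by (rule of_nat_mono)
  then show ?thesis
    using u_eps_diff_sq_ge[OF \<rho> \<epsilon> L ab, of X] unfolding H_def
    by (simp add: power2_eq_square algebra_simps)
qed

subsection \<open>Periodic sets and the kernel\<close>

text \<open>After translation by a multiple of \<open>l\<close> the interval starts in
  \<open>[0, l)\<close>. It then either fits into one period or wraps around once, and in neither
  case is length lost.\<close>

lemma emeasure_periodic_Icc_ge:
  fixes l p q :: real
  assumes "l > 0" "p \<le> q" "q - p \<le> l"
  shows "ennreal (q - p) \<le> emeasure lborel ({0..l} \<inter> {x. \<exists>k::int. x + l * of_int k \<in> {p..q}})"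
proof -
  let ?S = "{x. \<exists>k::int. x + l * of_int k \<in> {p..q}}"
  have [measurable]: "{0..l} \<inter> ?S \<in> sets lborel" by measurable
  define m where "m = \<lfloor>p / l\<rfloor>"
  have m: "0 \<le> p - l * m" "p - l * m < l"
    using assms(1) iffD1[OF pos_le_divide_eq[OF assms(1)] of_int_floor_le[of "p / l"]]
      floor_correct[of "p / l"]
    by (auto simp: m_def pos_divide_less_eq algebra_simps)
  have S1: "x \<in> ?S" if "p - l * m \<le> x" "x \<le> q - l * m" for x
    using that by (auto intro!: exI[of _ m])
  have S2: "x \<in> ?S" if "p - l * m - l \<le> x" "x \<le> q - l * m - l" for x
    using that by (auto intro!: exI[of _ "m + 1"] simp: algebra_simps)
  show ?thesis
  proof (cases "q - l * m \<le> l")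
    case True
    then have "{p - l * m..q - l * m} \<subseteq> {0..l} \<inter> ?S"
      using S1 m by force
    then have "emeasure lborel {p - l * m..q - l * m} \<le> emeasure lborel ({0..l} \<inter> ?S)"
      by (intro emeasure_mono) measurable
    then show ?thesis using assms by simp
  next
    case False
    \<comment> \<open>The wrapped piece is half-open so that the two pieces are disjoint even when
      \<open>q - p = l\<close>.\<close>
    have "{0..<q - l * m - l} \<union> {p - l * m..l} \<subseteq> {0..l} \<inter> ?S"
    proof
      fix x assume "x \<in> {0..<q - l * m - l} \<union> {p - l * m..l}"
      then show "x \<in> {0..l} \<inter> ?S"
        using S1[of x] S2[of x] m assms False by (cases "x \<in> {p - l * m..l}") auto
    qed
    then have "emeasure lborel ({0..<q - l * m - l} \<union> {p - l * m..l}) \<le> emeasure lborel ({0..l} \<inter> ?S)"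
      by (intro emeasure_mono) measurable
    also have "emeasure lborel ({0..<q - l * m - l} \<union> {p - l * m..l}) =
        emeasure lborel {0..<q - l * m - l} + emeasure lborel {p - l * m..l}"
      using assms by (intro plus_emeasure[symmetric]) auto
    also have "\<dots> = ennreal (q - p)"
      using m False by (simp add: ennreal_plus[symmetric] del: ennreal_plus)
    finally show ?thesis .
  qed
qed

lemma nn_integral_real_translate:
  "f \<in> borel_measurable borel \<Longrightarrow> (\<integral>\<^sup>+y. f (y - x) \<partial>lborel) = (\<integral>\<^sup>+t. f t \<partial>lborel)" for x :: real
  by (subst nn_integral_real_affine[where c=1 and t=x]) auto

lemma nn_integral_real_reflect:
  "f \<in> borel_measurable borel \<Longrightarrow> (\<integral>\<^sup>+y. f (x - y) \<partial>lborel) = (\<integral>\<^sup>+t. f t \<partial>lborel)" for x :: real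
  by (subst nn_integral_real_affine[where c="-1" and t=x]) auto

text \<open>The substitutions \<open>y = x + t\<close> and \<open>y = x - t\<close> cover disjoint
  ranges because \<open>r > 0\<close>, so both one-sided bounds contribute in full.\<close>

lemma nn_integral_ge_two_sided:
  fixes F :: "real \<Rightarrow> ennreal"
  assumes [measurable]: "G \<in> borel_measurable borel" "H \<in> borel_measurable borel"
    and "r > 0" and "\<And>t. t \<in> {r..a} \<Longrightarrow> G t \<le> F (x + t)" "\<And>t. t \<in> {r..a} \<Longrightarrow> H t \<le> F (x - t)"
  shows "(\<integral>\<^sup>+t\<in>{r..a}. G t \<partial>lborel) + (\<integral>\<^sup>+t\<in>{r..a}. H t \<partial>lborel) \<le> (\<integral>\<^sup>+y. F y \<partial>lborel)"
proof -
  have "(\<integral>\<^sup>+t\<in>{r..a}. G t \<partial>lborel) = (\<integral>\<^sup>+y. G (y - x) * indicator {r..a} (y - x) \<partial>lborel)"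
    by (rule nn_integral_real_translate[symmetric]) measurable
  moreover have "(\<integral>\<^sup>+t\<in>{r..a}. H t \<partial>lborel) = (\<integral>\<^sup>+y. H (x - y) * indicator {r..a} (x - y) \<partial>lborel)"
    by (rule nn_integral_real_reflect[symmetric]) measurable
  ultimately have "(\<integral>\<^sup>+t\<in>{r..a}. G t \<partial>lborel) + (\<integral>\<^sup>+t\<in>{r..a}. H t \<partial>lborel) =
      (\<integral>\<^sup>+y. G (y - x) * indicator {r..a} (y - x) + H (x - y) * indicator {r..a} (x - y) \<partial>lborel)"
    by (simp add: nn_integral_add)
  also have "\<dots> \<le> (\<integral>\<^sup>+y. F y \<partial>lborel)"
  proof (rule nn_integral_mono)
    fix y :: real
    show "G (y - x) * indicator {r..a} (y - x) + H (x - y) * indicator {r..a} (x - y) \<le> F y"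
      using assms(4)[of "y - x"] assms(5)[of "x - y"] \<open>r > 0\<close> by (auto simp: indicator_def)
  qed
  finally show ?thesis .
qed

section \<open>The weighted kernel integral and its comparison with \<open>\<sigma>\<close>\<close>

text \<open>The factor \<open>1 - 4 * t\<close> comes from the loss in the squared increments,
  \<open>t - r\<close> from averaging over a period. Multiplied out, the integrand is a sum of three
  powers of \<open>t\<close> with explicit primitives; the contributions singular as
  \<open>r\<close> tends to 0 form \<open>\<sigma> s (r / 2)\<close>, and the rest is bounded below
  by a constant depending only on \<open>s\<close>.\<close>

lemma kernel_integral:
  fixes s :: real
  assumes "1/2 \<le> s" "s < 1"
  shows "\<exists>V K. \<forall>r. 0 < r \<and> r < 1/4 \<longrightarrow>
    (\<integral>\<^sup>+t\<in>{r..1/4}. ennreal (t powr (-1 - 2 * s) * ((1 - 4 * t) * (t - r))) \<partial>lborel) = ennreal (V r) \<and>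
    0 \<le> V r \<and> \<sigma> s (r / 2) - K \<le> V r"
proof -
  define H where "H t = (if s = 1/2 then ln t else t powr (1 - 2 * s) / (1 - 2 * s))" for t :: real
  have H': "(H has_real_derivative t powr (- 2 * s)) (at t)" if "t > 0" for t
  proof (cases "s = 1/2")
    case True
    with that show ?thesis unfolding H_def[abs_def]
      by (auto intro!: derivative_eq_intros simp: powr_minus field_simps)
  next
    case False
    have "((\<lambda>t. t powr (1 - 2 * s) / (1 - 2 * s)) has_real_derivative
        (1 - 2 * s) * t powr (1 - 2 * s - 1) / (1 - 2 * s)) (at t)"
      using that by (intro DERIV_cdivide has_real_derivative_powr)
    with False show ?thesis unfolding H_def[abs_def] by simp
  qed
  \<comment> \<open>Termwise primitive, from
    \<open>(1 - 4 * t) * (t - r) = (1 + 4 * r) * t - r - 4 * t\<^sup>2\<close>; \<open>H\<close>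
    integrates \<open>t powr (- 2 * s)\<close>, logarithmically if \<open>s = 1/2\<close>.\<close>
  define F where "F r t = (1 + 4 * r) * H t + r * t powr (- 2 * s) / (2 * s) - 4 * t powr (2 - 2 * s) / (2 - 2 * s)"
    for r t
  have F': "(F r has_real_derivative t powr (-1 - 2 * s) * ((1 - 4 * t) * (t - r))) (at t)" if "t > 0" for r t
  proof -
    have "(F r has_real_derivative (1 + 4 * r) * t powr (- 2 * s) + r * (- 2 * s * t powr (- 2 * s - 1)) / (2 * s)
        - 4 * ((2 - 2 * s) * t powr (2 - 2 * s - 1)) / (2 - 2 * s)) (at t)"
      unfolding F_def[abs_def] using that
      by (intro DERIV_diff DERIV_add DERIV_cmult DERIV_cdivide H' has_real_derivative_powr)
    also have "t powr (- 2 * s) = t * t powr (-1 - 2 * s)"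
      using that powr_add[of t 1 "-1 - 2 * s"] by simp
    also have "t powr (2 - 2 * s - 1) = t * t * t powr (-1 - 2 * s)"
      using that powr_add[of t 2 "-1 - 2 * s"] by (simp add: power2_eq_square)
    also have "- 2 * s - 1 = -1 - 2 * s" by simp
    also have "(1 + 4 * r) * (t * t powr (-1 - 2 * s)) + r * (- 2 * s * t powr (-1 - 2 * s)) / (2 * s)
        - 4 * ((2 - 2 * s) * (t * t * t powr (-1 - 2 * s))) / (2 - 2 * s) =
      t powr (-1 - 2 * s) * ((1 - 4 * t) * (t - r))"
      using assms by (simp add: field_simps)
    finally show ?thesis .
  qed
  define V where "V r = F r (1/4) - F r r" for r
  \<comment> \<open>The boundary terms at 1/4 that do not depend on \<open>r\<close>, and the offset
    between \<open>\<sigma>\<close> and the primitive in the logarithmic case.\<close>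
  define K where "K = (if s = 1/2 then ln 2 + 1 else 0) - H (1/4) + 4 * (1/4) powr (2 - 2 * s) / (2 - 2 * s)"
  have nn: "(\<integral>\<^sup>+t\<in>{r..1/4}. ennreal (t powr (-1 - 2 * s) * ((1 - 4 * t) * (t - r))) \<partial>lborel) = ennreal (V r)"
    if "0 < r" "r < 1/4" for r
    unfolding V_def by (rule nn_integral_FTC_Icc) (use that F' in auto)
  have mono: "G x \<le> G y" if "0 < x" "x \<le> y" "y \<le> b"
    and "\<And>t. 0 < t \<Longrightarrow> (G has_real_derivative g t) (at t)" "\<And>t. x \<le> t \<Longrightarrow> t \<le> b \<Longrightarrow> 0 \<le> g t"
    for G g :: "real \<Rightarrow> real" and x y b
  proof (rule DERIV_nonneg_imp_nondecreasing[OF \<open>x \<le> y\<close>])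
    fix t assume "x \<le> t" "t \<le> y"
    with that show "\<exists>d. (G has_real_derivative d) (at t) \<and> 0 \<le> d"
      by (intro exI[of _ "g t"]) auto
  qed
  have V0: "0 \<le> V r" if "0 < r" "r < 1/4" for r
    using mono[of r "1/4" "1/4" "F r", OF _ _ _ F'] that by (simp add: V_def)
  have "\<sigma> s (r / 2) - K \<le> V r" if r: "0 < r" "r < 1/4" for r
  proof -
    \<comment> \<open>Three nonnegative terms of \<open>V r\<close> are discarded; the one with
      factor \<open>4 * r\<close> has a sign because \<open>H\<close> increases.\<close>
    have "H r \<le> H (1/4)" using mono[of r "1/4" "1/4" H, OF _ _ _ H'] r by simp
    then have "0 \<le> 4 * r * (H (1/4) - H r)" using r by simp
    moreover have "0 \<le> r * (1/4) powr (- 2 * s) / (2 * s)" "0 \<le> 4 * r powr (2 - 2 * s) / (2 - 2 * s)"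
      using r assms by auto
    moreover have "V r = H (1/4) - H r + 4 * r * (H (1/4) - H r) + r * (1/4) powr (- 2 * s) / (2 * s)
        - r * r powr (- 2 * s) / (2 * s) - 4 * (1/4) powr (2 - 2 * s) / (2 - 2 * s)
        + 4 * r powr (2 - 2 * s) / (2 - 2 * s)"
      by (simp add: V_def F_def algebra_simps)
    moreover have "r * r powr (- 2 * s) = r powr (1 - 2 * s)"
      using r powr_add[of r 1 "- 2 * s"] by simp
    ultimately have "H (1/4) - H r - r powr (1 - 2 * s) / (2 * s) - 4 * (1/4) powr (2 - 2 * s) / (2 - 2 * s) \<le> V r"
      by simp
    moreover have "\<sigma> s (r / 2) - (if s = 1/2 then ln 2 + 1 else 0) = - H r - r powr (1 - 2 * s) / (2 * s)"
    proof (cases "s = 1/2")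
      case True
      then show ?thesis using r by (simp add: True \<sigma>_def H_def ln_div)
    next
      case False
      with assms have s: "2 * s - 1 > 0" "1 - 2 * s \<noteq> 0" by auto
      \<comment> \<open>The prefactor in \<open>\<sigma>\<close> is what the argument
        \<open>r / 2\<close> cancels. The next display is the partial fraction
        \<open>1 / (2s (2s - 1)) = 1 / (2s - 1) - 1 / (2s)\<close>.\<close>
      have "2 powr (1 - 2 * s) * (r / 2) powr (1 - 2 * s) = r powr (1 - 2 * s)"
        using r by (simp add: powr_mult[symmetric])
      then have "\<sigma> s (r / 2) = r powr (1 - 2 * s) / (2 * s * (2 * s - 1))"
        using False by (simp add: \<sigma>_def)
      also have "\<dots> = - (r powr (1 - 2 * s) / (1 - 2 * s)) - r powr (1 - 2 * s) / (2 * s)"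
        using s assms by (simp add: divide_simps) (simp add: algebra_simps)
      finally show ?thesis using False by (simp add: H_def)
    qed
    ultimately show ?thesis unfolding K_def by linarith
  qed
  with nn V0 show ?thesis by blast
qed

subsection \<open>The energy of a configuration with a close pair\<close>

text \<open>For \<open>c = 0\<close> the interval is a shrunk \<open>[x, x + t]\<close>, for \<open>c = 1\<close> a shrunk \<open>[x - t, x]\<close>.\<close>

definition hit :: "nat \<Rightarrow> (nat \<Rightarrow> real) \<Rightarrow> real \<Rightarrow> real \<Rightarrow> nat \<Rightarrow> real \<Rightarrow> real \<Rightarrow> bool" where
  "hit L X \<epsilon> c m x t \<longleftrightarrow>
     (\<exists>k::int. x - c * t + \<epsilon> \<le> X m + real L * of_int k \<and> X m + real L * of_int k \<le> x + (1 - c) * t - \<epsilon>)"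

lemma measurable_hit [measurable]:
  assumes [measurable]: "f \<in> borel_measurable M" "g \<in> borel_measurable M"
  shows "Measurable.pred M (\<lambda>p. hit L X \<epsilon> c m (f p) (g p))"
  unfolding hit_def by measurable

text \<open>The interval \<open>{p..q}\<close> fits into one period since its length is at most 1,
  hence at most \<open>L\<close>.\<close>

lemma nn_integral_periodic_ge:
  assumes "L \<ge> 1" and sub: "\<And>x k. x + real L * of_int k \<in> {p..q} \<Longrightarrow> P x" and "q - p = l" "0 \<le> l" "l \<le> 1"
    and [measurable]: "Measurable.pred borel P"
  shows "ennreal l \<le> (\<integral>\<^sup>+x\<in>{0..real L}. (if P x then 1 else 0) \<partial>lborel)"
proof -
  have "ennreal l \<le> emeasure lborel ({0..real L} \<inter> {x. \<exists>k::int. x + real L * of_int k \<in> {p..q}})"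
    using emeasure_periodic_Icc_ge[of "real L" p q] assms by simp
  also have "\<dots> \<le> emeasure lborel ({0..real L} \<inter> {x. P x})"
    using sub by (intro emeasure_mono) auto
  also have "\<dots> = (\<integral>\<^sup>+x. indicator ({0..real L} \<inter> {x. P x}) x \<partial>lborel)"
    by (rule nn_integral_indicator[symmetric]) measurable
  also have "\<dots> = (\<integral>\<^sup>+x\<in>{0..real L}. (if P x then 1 else 0) \<partial>lborel)"
    by (intro nn_integral_cong) (simp add: indicator_def)
  finally show ?thesis .
qed

text \<open>Solved for \<open>x\<close>, the hitting condition describes the translates of an
  interval of length \<open>t - 2 * \<epsilon>\<close>, whatever the value of
  \<open>c\<close>.\<close>

lemma nn_integral_hit_ge:
  assumes "L \<ge> 1" "2 * \<epsilon> \<le> t" "\<epsilon> > 0" "t \<le> 1"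
  shows "ennreal (t - 2 * \<epsilon>) \<le> (\<integral>\<^sup>+x\<in>{0..real L}. (if hit L X \<epsilon> c m x t then 1 else 0) \<partial>lborel)"
proof (rule nn_integral_periodic_ge)
  fix x k assume "x + real L * of_int k \<in> {X m - (1 - c) * t + \<epsilon>..X m + c * t - \<epsilon>}"
  then show "hit L X \<epsilon> c m x t"
    unfolding hit_def by (intro exI[of _ "- k"]) (auto simp: algebra_simps)
qed (use assms in \<open>auto simp: algebra_simps\<close>)

text \<open>Two intervals of length \<open>t - 2 * \<epsilon>\<close>, displaced by the distance of
  the pair, overlap in length at least \<open>t - r\<close>.\<close>

lemma nn_integral_hit_pair_ge:
  assumes "L \<ge> 1" "2 * \<epsilon> + \<bar>X i - X j - real L * of_int k0\<bar> \<le> r" "r \<le> t" "\<epsilon> > 0" "t \<le> 1"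
  shows "ennreal (t - r) \<le>
    (\<integral>\<^sup>+x\<in>{0..real L}. (if hit L X \<epsilon> c i x t \<and> hit L X \<epsilon> c j x t then 1 else 0) \<partial>lborel)"
proof (rule nn_integral_periodic_ge)
  \<comment> \<open>The larger of the two left endpoints, with the second point moved by
    \<open>k0\<close> periods next to the first.\<close>
  define a where "a = max (X i) (X j + real L * of_int k0) - (1 - c) * t + \<epsilon>"
  fix x k assume *: "x + real L * of_int k \<in> {a..a + (t - r)}"
  show "hit L X \<epsilon> c i x t \<and> hit L X \<epsilon> c j x t"
  proof
    show "hit L X \<epsilon> c i x t"
      unfolding hit_def using * assms by (intro exI[of _ "- k"]) (auto simp: algebra_simps a_def max_def split: if_splits)
    show "hit L X \<epsilon> c j x t"
      unfolding hit_def using * assms by (intro exI[of _ "k0 - k"]) (auto simp: algebra_simps a_def max_def split: if_splits)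
  qed
qed (use assms in auto)

text \<open>Exchanging the integrals in \<open>x\<close> and \<open>t\<close> reduces everything to
  averages over a period for fixed \<open>t\<close>, followed by the kernel integral. The two sides
  \<open>y = x + t\<close> and \<open>y = x - t\<close> give the same bound, and their sum cancels
  the factor 1/2 of the energy.\<close>

lemma energy_ge:
  assumes \<rho>: "standard_mollifier \<rho>" and \<epsilon>: "\<epsilon> > 0" and L: "L \<ge> 1"
    and ij: "i \<noteq> j" "i \<in> {1..L}" "j \<in> {1..L}"
    and k0: "2 * \<epsilon> + \<bar>X i - X j - real L * of_int k0\<bar> \<le> r" and r: "r < 1/4"
    and V: "\<And>r. 0 < r \<Longrightarrow> r < 1/4 \<Longrightarrow>
       (\<integral>\<^sup>+t\<in>{r..1/4}. ennreal (t powr (-1 - 2 * s) * ((1 - 4 * t) * (t - r))) \<partial>lborel) = ennreal (V r)"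
      "\<And>r. 0 < r \<Longrightarrow> r < 1/4 \<Longrightarrow> 0 \<le> V r"
  shows "ennreal (real L * V (2 * \<epsilon>) + 2 * V r) \<le> energy \<rho> s \<epsilon> L X"
proof -
  define w where "w t = t powr (-1 - 2 * s)" for t :: real
  \<comment> \<open>A minorant of the integrand built from indicators of hits; only the point count
    carries the loss \<open>1 - 4 * t\<close>.\<close>
  define g where "g c x t = ennreal (w t * (1 - 4 * t)) * (\<Sum>m\<in>{1..L}. if hit L X \<epsilon> c m x t then 1 else 0)
     + ennreal (2 * w t) * (if hit L X \<epsilon> c i x t \<and> hit L X \<epsilon> c j x t then 1 else 0)" for c x t
  define \<u> where "\<u> = u_eps \<rho> \<epsilon> L X"
  let ?F = "\<lambda>x y. ennreal (\<bar>\<u> x - \<u> y\<bar>\<^sup>2 / \<bar>x - y\<bar> powr (1 + 2 * s))"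
  have [measurable]: "(\<lambda>p. g c (fst p) (snd p)) \<in> borel_measurable (borel \<Otimes>\<^sub>M borel)"
    "g c x \<in> borel_measurable borel" "(\<lambda>x. g c x t) \<in> borel_measurable borel" for c x t
    unfolding g_def[abs_def] w_def by measurable
  have r0: "0 < 2 * \<epsilon>" "2 * \<epsilon> \<le> r" "0 < r" "2 * \<epsilon> < 1/4" using \<epsilon> k0 r by auto
  \<comment> \<open>One estimate for both sides: \<open>x\<close> is the left end of
    \<open>[a, b]\<close> if \<open>c = 0\<close> and the right end if \<open>c = 1\<close>.\<close>
  have g_le: "g c x t \<le> ennreal ((\<u> b - \<u> a)\<^sup>2 / t powr (1 + 2 * s))"
    if "a = x - c * t" "b = x + (1 - c) * t" "t \<in> {2 * \<epsilon>..1/4}" for a b c x t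
  proof -
    define H where "H = points_hit L X {a+\<epsilon>..b-\<epsilon>}"
    have H: "m \<in> H \<longleftrightarrow> m \<in> {1..L} \<and> hit L X \<epsilon> c m x t" for m
      using that by (auto simp: H_def points_hit_def hit_def)
    have "(\<Sum>m\<in>{1..L}. if hit L X \<epsilon> c m x t then 1 else 0 :: ennreal) = (\<Sum>m\<in>{1..L}. if m \<in> H then 1 else 0)"
      using H by (intro sum.cong) auto
    also have "\<dots> = (\<Sum>m\<in>H. 1)"
      using H by (intro sum.mono_neutral_cong_right) auto
    also have "\<dots> = ennreal (card H)" by (simp add: ennreal_of_nat_eq_real_of_nat)
    finally have "g c x t = ennreal (w t * (1 - 4 * t)) * ennreal (card H)
        + ennreal (2 * w t) * ennreal (of_bool (i \<in> H \<and> j \<in> H))"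
      using H ij by (simp add: g_def)
    also have "\<dots> = ennreal (w t * (1 - 4 * t) * card H + 2 * w t * of_bool (i \<in> H \<and> j \<in> H))"
    proof -
      have "ennreal p * ennreal q + ennreal p' * ennreal q' = ennreal (p * q + p' * q')"
        if "0 \<le> p" "0 \<le> q" "0 \<le> p'" "0 \<le> q'" for p q p' q'
        using that by (simp add: ennreal_mult)
      then show ?thesis using that(3) by (simp add: w_def)
    qed
    also have "\<dots> = ennreal (w t * ((1 - 4 * t) * card H + 2 * of_bool (i \<in> H \<and> j \<in> H)))"
      by (simp only: algebra_simps)
    also have "\<dots> \<le> ennreal (w t * (\<u> b - \<u> a)\<^sup>2)"
    proof (intro ennreal_leI mult_left_mono)
      have ba: "b - a = t" using that by (simp add: algebra_simps)
      then have "2 * \<epsilon> \<le> b - a" "b - a \<le> 1/4" using that(3) by auto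
      from u_eps_diff_sq_ge_pair[OF \<rho> \<epsilon> L this ij(1), of X]
      show "(1 - 4 * t) * card H + 2 * of_bool (i \<in> H \<and> j \<in> H) \<le> (\<u> b - \<u> a)\<^sup>2"
        unfolding ba H_def \<u>_def .
    qed (simp add: w_def)
    also have "w t * (\<u> b - \<u> a)\<^sup>2 = (\<u> b - \<u> a)\<^sup>2 / t powr (1 + 2 * s)"
      using powr_minus_divide[of t "1 + 2 * s"] by (simp add: w_def)
    finally show ?thesis .
  qed
  have inner: "(\<integral>\<^sup>+t\<in>{2 * \<epsilon>..1/4}. g 0 x t \<partial>lborel) + (\<integral>\<^sup>+t\<in>{2 * \<epsilon>..1/4}. g 1 x t \<partial>lborel)
      \<le> (\<integral>\<^sup>+y. ?F x y \<partial>lborel)" for x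
  proof (rule nn_integral_ge_two_sided)
    fix t assume t: "t \<in> {2 * \<epsilon>..1/4}"
    show "g 0 x t \<le> ?F x (x + t)"
      using g_le[of x x 0 t "x + t"] t \<epsilon> by (simp add: power2_commute)
    show "g 1 x t \<le> ?F x (x - t)"
      using g_le[of "x - t" x 1 t x] t \<epsilon> by simp
  qed (use \<epsilon> in \<open>simp_all add: g_def[abs_def] w_def[abs_def]\<close>)
  define \<Phi> where "\<Phi> c = (\<integral>\<^sup>+x\<in>{0..real L}. (\<integral>\<^sup>+t\<in>{2 * \<epsilon>..1/4}. g c x t \<partial>lborel) \<partial>lborel)" for c
  have "ennreal (real L * V (2 * \<epsilon>) + 2 * V r) \<le> \<Phi> c" for c
  proof -
    have "\<Phi> c = (\<integral>\<^sup>+x. (\<integral>\<^sup>+t. g c x t * indicator {2 * \<epsilon>..1/4} t * indicator {0..real L} x \<partial>lborel) \<partial>lborel)"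
      unfolding \<Phi>_def by (intro nn_integral_cong nn_integral_multc[symmetric]) simp
    \<comment> \<open>From here on \<open>t\<close> is fixed and the average over \<open>x\<close>
      is inner, where the bounds on hits apply.\<close>
    also have "\<dots> = (\<integral>\<^sup>+t. (\<integral>\<^sup>+x. g c x t * indicator {2 * \<epsilon>..1/4} t * indicator {0..real L} x \<partial>lborel) \<partial>lborel)"
      by (rule lborel_pair.Fubini'[symmetric]) (simp add: case_prod_unfold, measurable)
    also have "\<dots> \<ge> (\<integral>\<^sup>+t. of_nat L * (ennreal (t powr (-1 - 2 * s) * ((1 - 4 * t) * (t - 2 * \<epsilon>))) * indicator {2 * \<epsilon>..1/4} t)
        + 2 * (ennreal (t powr (-1 - 2 * s) * ((1 - 4 * t) * (t - r))) * indicator {r..1/4} t) \<partial>lborel)"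
    proof (rule nn_integral_mono)
      fix t :: real
      show "of_nat L * (ennreal (t powr (-1 - 2 * s) * ((1 - 4 * t) * (t - 2 * \<epsilon>))) * indicator {2 * \<epsilon>..1/4} t)
        + 2 * (ennreal (t powr (-1 - 2 * s) * ((1 - 4 * t) * (t - r))) * indicator {r..1/4} t)
        \<le> (\<integral>\<^sup>+x. g c x t * indicator {2 * \<epsilon>..1/4} t * indicator {0..real L} x \<partial>lborel)"
      proof (cases "t \<in> {2 * \<epsilon>..1/4}")
        case False
        then show ?thesis using r0 by (auto simp: indicator_def)
      next
        case True
        let ?h = "\<lambda>m x. if hit L X \<epsilon> c m x t then 1 else 0 :: ennreal"
        let ?hh = "\<lambda>x. if hit L X \<epsilon> c i x t \<and> hit L X \<epsilon> c j x t then 1 else 0 :: ennreal"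
        have "(\<integral>\<^sup>+x. g c x t * indicator {2 * \<epsilon>..1/4} t * indicator {0..real L} x \<partial>lborel) =
          (\<integral>\<^sup>+x. ennreal (w t * (1 - 4 * t)) * (\<Sum>m\<in>{1..L}. ?h m x * indicator {0..real L} x)
             + ennreal (2 * w t) * (?hh x * indicator {0..real L} x) \<partial>lborel)"
          using True by (intro nn_integral_cong) (simp add: g_def distrib_right sum_distrib_right mult.assoc)
        also have "\<dots> = ennreal (w t * (1 - 4 * t)) * (\<Sum>m\<in>{1..L}. \<integral>\<^sup>+x\<in>{0..real L}. ?h m x \<partial>lborel)
            + ennreal (2 * w t) * (\<integral>\<^sup>+x\<in>{0..real L}. ?hh x \<partial>lborel)"
          by (subst nn_integral_sum[symmetric]) (simp_all add: nn_integral_add nn_integral_cmult)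
        also have "\<dots> \<ge> ennreal (w t * (1 - 4 * t)) * (\<Sum>m\<in>{1..L}. ennreal (t - 2 * \<epsilon>))
            + ennreal (2 * w t) * (ennreal (t - r) * indicator {r..} t)"
        proof (intro add_mono mult_left_mono sum_mono)
          show "ennreal (t - 2 * \<epsilon>) \<le> (\<integral>\<^sup>+x\<in>{0..real L}. ?h m x \<partial>lborel)" for m
            using True \<epsilon> L by (intro nn_integral_hit_ge) auto
          show "ennreal (t - r) * indicator {r..} t \<le> (\<integral>\<^sup>+x\<in>{0..real L}. ?hh x \<partial>lborel)"
          proof (cases "r \<le> t")
            case r_le: True
            have "ennreal (t - r) \<le> (\<integral>\<^sup>+x\<in>{0..real L}. ?hh x \<partial>lborel)"
              by (rule nn_integral_hit_pair_ge[OF L k0 r_le \<epsilon>]) (use True in auto)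
            then show ?thesis using r_le by simp
          qed simp
        qed auto
        finally have *: "ennreal (w t * (1 - 4 * t)) * (\<Sum>m\<in>{1..L}. ennreal (t - 2 * \<epsilon>))
            + ennreal (2 * w t) * (ennreal (t - r) * indicator {r..} t)
            \<le> (\<integral>\<^sup>+x. g c x t * indicator {2 * \<epsilon>..1/4} t * indicator {0..real L} x \<partial>lborel)" .
        have e1: "of_nat L * (ennreal (t powr (-1 - 2 * s) * ((1 - 4 * t) * (t - 2 * \<epsilon>))) * indicator {2 * \<epsilon>..1/4} t)
          = ennreal (w t * (1 - 4 * t)) * (\<Sum>m\<in>{1..L}. ennreal (t - 2 * \<epsilon>))"
        proof -
          have "ennreal (t powr (-1 - 2 * s) * ((1 - 4 * t) * (t - 2 * \<epsilon>)))
              = ennreal (w t * (1 - 4 * t)) * ennreal (t - 2 * \<epsilon>)"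
            using True by (subst ennreal_mult[symmetric]) (auto simp: w_def mult.assoc)
          then show ?thesis using True by (simp add: mult.left_commute)
        qed
        \<comment> \<open>The factor \<open>1 - 4 * t \<le> 1\<close> is inserted only so that the
          pair term is governed by the same function \<open>V\<close> as the points.\<close>
        have e2: "2 * (ennreal (t powr (-1 - 2 * s) * ((1 - 4 * t) * (t - r))) * indicator {r..1/4} t)
          \<le> ennreal (2 * w t) * (ennreal (t - r) * indicator {r..} t)"
        proof (cases "r \<le> t")
          case r_le: True
          have "2 * ennreal (w t * ((1 - 4 * t) * (t - r))) = ennreal (2 * w t * ((1 - 4 * t) * (t - r)))"
            using True r_le by (simp add: ennreal_mult w_def mult.assoc)
          also have "\<dots> \<le> ennreal (2 * w t * (t - r))"
            using True r_le \<epsilon> by (intro ennreal_leI mult_left_mono mult_left_le_one_le) (auto simp: w_def)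
          also have "\<dots> = ennreal (2 * w t) * ennreal (t - r)"
            using r_le by (simp add: ennreal_mult w_def)
          finally show ?thesis using True r_le by (simp add: w_def)
        qed simp
        show ?thesis unfolding e1 by (rule order_trans[OF add_left_mono[OF e2] *])
      qed
    qed
    finally have "\<Phi> c \<ge> (\<integral>\<^sup>+t. of_nat L * (ennreal (t powr (-1 - 2 * s) * ((1 - 4 * t) * (t - 2 * \<epsilon>))) * indicator {2 * \<epsilon>..1/4} t)
        + 2 * (ennreal (t powr (-1 - 2 * s) * ((1 - 4 * t) * (t - r))) * indicator {r..1/4} t) \<partial>lborel)" .
    also have "(\<integral>\<^sup>+t. of_nat L * (ennreal (t powr (-1 - 2 * s) * ((1 - 4 * t) * (t - 2 * \<epsilon>))) * indicator {2 * \<epsilon>..1/4} t)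
        + 2 * (ennreal (t powr (-1 - 2 * s) * ((1 - 4 * t) * (t - r))) * indicator {r..1/4} t) \<partial>lborel)
      = of_nat L * ennreal (V (2 * \<epsilon>)) + 2 * ennreal (V r)"
      using V(1)[OF r0(1,4)] V(1)[OF r0(3) r] by (simp add: nn_integral_add nn_integral_cmult)
    also have "\<dots> = ennreal (real L * V (2 * \<epsilon>) + 2 * V r)"
      using V(2)[OF r0(1,4)] V(2)[OF r0(3) r]
      by (simp add: ennreal_of_nat_eq_real_of_nat ennreal_mult)
    finally show ?thesis .
  qed
  then have "ennreal (real L * V (2 * \<epsilon>) + 2 * V r) + ennreal (real L * V (2 * \<epsilon>) + 2 * V r) \<le> \<Phi> 0 + \<Phi> 1"
    by (intro add_mono)
  also have "\<dots> = (\<integral>\<^sup>+x\<in>{0..real L}. (\<integral>\<^sup>+t\<in>{2 * \<epsilon>..1/4}. g 0 x t \<partial>lborel) +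
      (\<integral>\<^sup>+t\<in>{2 * \<epsilon>..1/4}. g 1 x t \<partial>lborel) \<partial>lborel)"
    unfolding \<Phi>_def distrib_right by (intro nn_integral_add[symmetric]) measurable
  also have "\<dots> \<le> (\<integral>\<^sup>+x\<in>{0..real L}. (\<integral>\<^sup>+y. ?F x y \<partial>lborel) \<partial>lborel)"
    by (intro nn_integral_mono mult_right_mono inner) auto
  finally have "ennreal (1/2) * (ennreal (real L * V (2 * \<epsilon>) + 2 * V r) + ennreal (real L * V (2 * \<epsilon>) + 2 * V r))
      \<le> energy \<rho> s \<epsilon> L X"
    unfolding energy_def \<u>_def by (intro mult_left_mono) auto
  moreover have half: "ennreal (1/2) * (ennreal A + ennreal A) = ennreal A" if "0 \<le> A" for A
  proof -
    have "ennreal A = ennreal (1/2 * (A + A))" by simp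
    also have "\<dots> = ennreal (1/2) * ennreal (A + A)" using that by (intro ennreal_mult) auto
    finally show ?thesis using that by (simp only: ennreal_plus)
  qed
  moreover have "0 \<le> real L * V (2 * \<epsilon>) + 2 * V r"
    using V(2)[OF r0(1,4)] V(2)[OF r0(3) r] by simp
  ultimately show ?thesis by (simp only: half)
qed

subsection \<open>The lower bound\<close>

text \<open>Logarithmic blow-up for \<open>s = 1/2\<close>, a negative power otherwise. It lets
  \<open>\<sigma> s \<delta>\<close> absorb any constant.\<close>

lemma filterlim_\<sigma>_at_right_0:
  assumes "1/2 \<le> s" "s < 1"
  shows "filterlim (\<sigma> s) at_top (at_right 0)"
proof -
  have ln: "filterlim (\<lambda>x. - ln x) at_top (at_right (0::real))"
    using ln_at_0 by (simp add: filterlim_uminus_at_bot)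
  show ?thesis
  proof (cases "s = 1/2")
    case True
    have "filterlim (\<lambda>x. \<bar>ln x\<bar>) at_top (at_right (0::real))"
      using ln by (rule filterlim_at_top_mono) (auto intro: always_eventually)
    with True show ?thesis by (simp add: \<sigma>_def[abs_def])
  next
    case False
    with assms have s: "2 * s - 1 > 0" "2 powr (1 - 2 * s) / (2 * s * (2 * s - 1)) > 0" by auto
    have "filterlim (\<lambda>x. x powr (1 - 2 * s)) at_top (at_right (0::real))"
    proof (rule filterlim_cong[THEN iffD1, OF refl refl])
      show "\<forall>\<^sub>F x in at_right 0. exp ((2 * s - 1) * - ln x) = x powr (1 - 2 * s)"
        by (auto simp: powr_def eventually_at_filter algebra_simps)
      show "filterlim (\<lambda>x. exp ((2 * s - 1) * - ln x)) at_top (at_right (0::real))"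
        using s(1) by (intro filterlim_compose[OF exp_at_top] filterlim_tendsto_pos_mult_at_top[OF tendsto_const _ ln])
    qed
    with s(2) have "filterlim (\<lambda>x. 2 powr (1 - 2 * s) / (2 * s * (2 * s - 1)) * x powr (1 - 2 * s)) at_top (at_right (0::real))"
      by (intro filterlim_tendsto_pos_mult_at_top[OF tendsto_const])
    with False show ?thesis by (simp add: \<sigma>_def[abs_def])
  qed
qed

text \<open>\<open>\<delta> < 1\<close> excludes \<open>L = 1\<close>, where \<open>min_dist\<close>
  is 1 by convention. The slack \<open>\<eta>\<close> yields an integer close to the infimum in
  \<open>per_abs\<close> without showing that it is attained.\<close>

lemma min_dist_le_imp_close_pair:
  assumes "min_dist L X \<le> \<delta>" "\<delta> < 1" "0 < \<eta>" "L \<ge> 1"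
  obtains i j k0 where "i \<noteq> j" "i \<in> {1..L}" "j \<in> {1..L}"
    "\<bar>X i - X j - real L * of_int k0\<bar> < \<delta> + \<eta>"
proof -
  have L: "L \<noteq> 1" using assms(1,2) by (auto simp: min_dist_def)
  let ?S = "{per_abs L (X i - X j) | i j. i \<in> {1..L} \<and> j \<in> {1..L} \<and> i \<noteq> j}"
  have fin: "finite ?S"
    by (rule finite_subset[of _ "(\<lambda>(i, j). per_abs L (X i - X j)) ` ({1..L} \<times> {1..L})"]) auto
  have "per_abs L (X 1 - X 2) \<in> ?S" using L assms(4) by (intro CollectI exI[of _ 1] exI[of _ 2]) auto
  then have "Min ?S \<in> ?S" using fin by (intro Min_in) auto
  moreover have "Min ?S \<le> \<delta>" using assms(1) L by (simp add: min_dist_def)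
  ultimately obtain i j where ij: "i \<noteq> j" "i \<in> {1..L}" "j \<in> {1..L}" "per_abs L (X i - X j) \<le> \<delta>"
    by auto
  from ij(4) have "(INF z::int. \<bar>X i - X j + real L * of_int z\<bar>) < \<delta> + \<eta>"
    using assms(3) by (simp add: per_abs_def)
  then obtain z :: int where "\<bar>X i - X j + real L * of_int z\<bar> < \<delta> + \<eta>"
    by (subst (asm) cINF_less_iff) (auto intro!: bdd_belowI[of _ 0])
  then show thesis using that[OF ij(1-3), of "- z"] by simp
qed

theorem proposition3p3:
  fixes s :: real
  assumes "1/2 \<le> s" and "s < 1"
  shows "\<exists>C>0. \<forall>L::nat. L \<ge> 1 \<longrightarrow>
           (\<exists>\<delta>\<^sub>0>0. \<forall>\<rho>. standard_mollifier \<rho> \<longrightarrow>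
             (\<forall>\<delta>::real. 0 < \<delta> \<and> \<delta> < \<delta>\<^sub>0 \<longrightarrow>
                Liminf (at_right 0)
                  (\<lambda>\<epsilon>. (INF X\<in>{X \<in> configs L. min_dist L X \<le> \<delta>}. enn2ereal (energy \<rho> s \<epsilon> L X))
                        - ereal (real L * \<sigma> s \<epsilon>))
                \<ge> ereal (C * \<sigma> s \<delta>)))"
\<comment> \<open>The pair supplies \<open>2 * \<sigma> s \<delta>\<close>; one copy pays for the
  errors, so 1 remains as the constant.\<close>
proof (rule exI[of _ 1], intro conjI allI impI)
  fix L :: nat assume L: "L \<ge> 1"
  obtain V K where VK: "\<forall>r. 0 < r \<and> r < 1/4 \<longrightarrow>
    (\<integral>\<^sup>+t\<in>{r..1/4}. ennreal (t powr (-1 - 2 * s) * ((1 - 4 * t) * (t - r))) \<partial>lborel) = ennreal (V r) \<and>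
    0 \<le> V r \<and> \<sigma> s (r / 2) - K \<le> V r"
    using kernel_integral[OF assms] by blast
  have V:
    "(\<integral>\<^sup>+t\<in>{r..1/4}. ennreal (t powr (-1 - 2 * s) * ((1 - 4 * t) * (t - r))) \<partial>lborel) = ennreal (V r)"
    "0 \<le> V r" "\<sigma> s (r / 2) - K \<le> V r" if "0 < r" "r < 1/4" for r
    using VK that by blast+
  \<comment> \<open>The total error: \<open>K\<close> for each of the \<open>L\<close> points and
    twice \<open>K\<close> for the pair.\<close>
  have "eventually (\<lambda>\<delta>. (real L + 2) * K \<le> \<sigma> s \<delta>) (at_right 0)"
    using filterlim_\<sigma>_at_right_0[OF assms] by (simp add: filterlim_at_top)
  then obtain b where b: "b > 0" "\<And>\<delta>. 0 < \<delta> \<Longrightarrow> \<delta> < b \<Longrightarrow> (real L + 2) * K \<le> \<sigma> s \<delta>"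
    by (auto simp: eventually_at_right_field)
  show "\<exists>\<delta>\<^sub>0>0. \<forall>\<rho>. standard_mollifier \<rho> \<longrightarrow>
             (\<forall>\<delta>::real. 0 < \<delta> \<and> \<delta> < \<delta>\<^sub>0 \<longrightarrow>
                ereal (1 * \<sigma> s \<delta>) \<le> Liminf (at_right 0)
                  (\<lambda>\<epsilon>. (INF X\<in>{X \<in> configs L. min_dist L X \<le> \<delta>}. enn2ereal (energy \<rho> s \<epsilon> L X))
                        - ereal (real L * \<sigma> s \<epsilon>)))"
  \<comment> \<open>Below \<open>b\<close> the errors are absorbed; the bound 1/8 gives
    \<open>2 * \<delta> < 1/4\<close>, as \<open>energy_ge\<close> requires of its parameter
    \<open>r = 2 * \<delta>\<close>.\<close>
  proof (intro exI[of _ "min b (1/8)"] conjI allI impI)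
    fix \<rho> and \<delta> :: real
    assume \<rho>: "standard_mollifier \<rho>" and "0 < \<delta> \<and> \<delta> < min b (1/8)"
    then have \<delta>: "0 < \<delta>" "\<delta> < min b (1/8)" by auto
    have "\<forall>\<^sub>F \<epsilon> in at_right 0. ereal (1 * \<sigma> s \<delta>) \<le>
        (INF X\<in>{X \<in> configs L. min_dist L X \<le> \<delta>}. enn2ereal (energy \<rho> s \<epsilon> L X)) - ereal (real L * \<sigma> s \<epsilon>)"
    proof (rule eventually_at_rightI)
      show "0 < \<delta> / 4" using \<delta> by simp
      fix \<epsilon> :: real assume "\<epsilon> \<in> {0<..<\<delta>/4}"
      \<comment> \<open>With slack \<open>\<delta> / 2\<close> in the pair distance,
        \<open>2 * \<epsilon> + 3/2 * \<delta> < 2 * \<delta>\<close>.\<close>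
      then have \<epsilon>: "0 < \<epsilon>" "\<epsilon> < \<delta> / 4" by auto
      have "ereal (\<sigma> s \<delta> + real L * \<sigma> s \<epsilon>) \<le> enn2ereal (energy \<rho> s \<epsilon> L X)"
        if X: "min_dist L X \<le> \<delta>" for X
      proof -
        obtain i j k0 where ij: "i \<noteq> j" "i \<in> {1..L}" "j \<in> {1..L}"
            and k0: "\<bar>X i - X j - real L * of_int k0\<bar> < \<delta> + \<delta> / 2"
          using min_dist_le_imp_close_pair[OF X, of "\<delta> / 2"] \<delta> L by auto
        have "ennreal (real L * V (2 * \<epsilon>) + 2 * V (2 * \<delta>)) \<le> energy \<rho> s \<epsilon> L X"
          by (rule energy_ge[OF \<rho> \<epsilon>(1) L ij, of X k0]) (use k0 \<delta> \<epsilon> V in auto)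
        moreover have "0 \<le> real L * V (2 * \<epsilon>) + 2 * V (2 * \<delta>)"
          using V(2)[of "2 * \<epsilon>"] V(2)[of "2 * \<delta>"] \<delta> \<epsilon> by simp
        ultimately have "ereal (real L * V (2 * \<epsilon>) + 2 * V (2 * \<delta>)) \<le> enn2ereal (energy \<rho> s \<epsilon> L X)"
          by (simp only: less_eq_ennreal.rep_eq enn2ereal_ennreal)
        moreover have "\<sigma> s \<delta> + real L * \<sigma> s \<epsilon> \<le> real L * V (2 * \<epsilon>) + 2 * V (2 * \<delta>)"
        proof -
          have "real L * (\<sigma> s \<epsilon> - K) \<le> real L * V (2 * \<epsilon>)"
            using V(3)[of "2 * \<epsilon>"] \<delta> \<epsilon> by (intro mult_left_mono) auto
          moreover have "\<sigma> s \<delta> - K \<le> V (2 * \<delta>)" using V(3)[of "2 * \<delta>"] \<delta> by simp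
          moreover have "(real L + 2) * K \<le> \<sigma> s \<delta>" using b(2) \<delta> by simp
          ultimately show ?thesis by (simp add: algebra_simps)
        qed
        then have "ereal (\<sigma> s \<delta> + real L * \<sigma> s \<epsilon>) \<le> ereal (real L * V (2 * \<epsilon>) + 2 * V (2 * \<delta>))"
          by simp
        ultimately show ?thesis by (rule order_trans[rotated])
      qed
      \<comment> \<open>If no configuration qualifies, as for \<open>L = 1\<close>, the infimum is
        infinite and the bound still holds.\<close>
      then have "ereal (\<sigma> s \<delta> + real L * \<sigma> s \<epsilon>) \<le>
          (INF X\<in>{X \<in> configs L. min_dist L X \<le> \<delta>}. enn2ereal (energy \<rho> s \<epsilon> L X))"
        by (intro INF_greatest) auto
      then show "ereal (1 * \<sigma> s \<delta>) \<le>
          (INF X\<in>{X \<in> configs L. min_dist L X \<le> \<delta>}. enn2ereal (energy \<rho> s \<epsilon> L X)) - ereal (real L * \<sigma> s \<epsilon>)"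
        by (simp add: ereal_le_minus)
    qed
    then show "ereal (1 * \<sigma> s \<delta>) \<le> Liminf (at_right 0)
        (\<lambda>\<epsilon>. (INF X\<in>{X \<in> configs L. min_dist L X \<le> \<delta>}. enn2ereal (energy \<rho> s \<epsilon> L X)) - ereal (real L * \<sigma> s \<epsilon>))"
      by (rule Liminf_bounded)
  qed (use b in auto)
qed simp

end
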